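(* As $\mathbb{C}$-algebras, the skew polynomial ring $\mathcal{M}[\xi;1,\delta]$ is isomorphic to $\mathcal{R}$ (via $E_4^iE_6^j\xi^k\mapsto e_4^ie_6^j\delta^k$).
   Context: Let $\mathrm{Hol}$ be the space of holomorphic functions on the upper half plane, $q=e^{2\pi iz}$, $f'=\frac{1}{2\pi i}\frac{df}{dz}$, and $E_2,E_4,E_6$ the Eisenstein series with constant term $1$. For $k\in\mathbb{R}$ let $D_kf=f'-\frac{k}{12}E_2f$. Let $H=\bigoplus_{n\in\mathbb{R}}H_n$ where each $H_n$ is a copy of $\mathrm{Hol}$, elements written $(f,n)$, with product $(f,n)(g,m)=(fg,n+m)$. $\mathrm{End}^i(H)$ denotes the $\mathbb{C}$-linear maps sending each $H_n$ into $H_{n+i}$ and $\mathrm{End}(H)=\bigoplus_i\mathrm{End}^i(H)$. Define $\delta(f,n)=(D_nf,n+2)$, $e_4(f,n)=(E_4f,n+4)$, $e_6(f,n)=(E_6f,n+6)$; $\mathcal{R}$ is the $\mathbb{C}$-subalgebra of $\mathrm{End}(H)$ generated by $\delta,e_4,e_6$. $\mathcal{M}=\mathbb{C}[E_4,E_6]=\bigoplus_k\mathcal{M}_k$ is the graded ring of level-one holomorphic modular forms, and $\delta$ acts on it as the derivation $f\mapsto D_kf$ for $f\in\mathcal{M}_k$. For a ring $R$, a ring endomorphism $s$ and an $s$-derivation $d$, $R[\xi;s,d]$ is the skew polynomial ring: every element is uniquely a finite sum $\sum r_i\xi^i$ with $r_i\in R$, and $\xi r=s(r)\xi+d(r)$;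 here $s=1$ is the identity. *)

theory Defs
  imports "HOL-Analysis.Analysis"
begin

definition uhp :: "complex set" where
  "uhp = {z. Im z > 0}"

text \<open>A function on the upper half plane is encoded as a function complex to complex
  that vanishes off the upper half plane.\<close>
definition onH :: "(complex \<Rightarrow> complex) \<Rightarrow> complex \<Rightarrow> complex" where
  "onH f = (\<lambda>z. if z \<in> uhp then f z else 0)"

definition Hol :: "(complex \<Rightarrow> complex) set" where
  "Hol = {f. f holomorphic_on uhp \<and> (\<forall>z. z \<notin> uhp \<longrightarrow> f z = 0)}"

definition qvar :: "complex \<Rightarrow> complex" where
  "qvar z = exp (2 * of_real pi * \<i> * z)"

definition divsigma :: "nat \<Rightarrow> nat \<Rightarrow> complex" where
  "divsigma k n = (\<Sum>d\<in>{d. d dvd n}. of_nat d ^ k)"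

definition E2 :: "complex \<Rightarrow> complex" where
  "E2 = onH (\<lambda>z. 1 - 24 * (\<Sum>n. divsigma 1 (Suc n) * qvar z ^ Suc n))"

definition E4 :: "complex \<Rightarrow> complex" where
  "E4 = onH (\<lambda>z. 1 + 240 * (\<Sum>n. divsigma 3 (Suc n) * qvar z ^ Suc n))"

definition E6 :: "complex \<Rightarrow> complex" where
  "E6 = onH (\<lambda>z. 1 - 504 * (\<Sum>n. divsigma 5 (Suc n) * qvar z ^ Suc n))"

definition qderiv :: "(complex \<Rightarrow> complex) \<Rightarrow> complex \<Rightarrow> complex" where
  "qderiv f = onH (\<lambda>z. deriv f z / (2 * of_real pi * \<i>))"

definition Dser :: "real \<Rightarrow> (complex \<Rightarrow> complex) \<Rightarrow> complex \<Rightarrow> complex" where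
  "Dser k f = (\<lambda>z. qderiv f z - of_real k / 12 * E2 z * f z)"

type_synonym gr = "real \<Rightarrow> complex \<Rightarrow> complex"

definition supp :: "gr \<Rightarrow> real set" where
  "supp h = {n. h n \<noteq> (\<lambda>_. 0)}"

definition Hcar :: "gr set" where
  "Hcar = {h. finite (supp h) \<and> (\<forall>n. h n \<in> Hol)}"

definition hom :: "real \<Rightarrow> (complex \<Rightarrow> complex) \<Rightarrow> gr" where
  "hom n f = (\<lambda>m. if m = n then f else (\<lambda>_. 0))"

text \<open>graded product (f,n)(g,m) = (fg,n+m), extended bilinearly\<close>
definition grmult :: "gr \<Rightarrow> gr \<Rightarrow> gr" where
  "grmult r h = (\<lambda>n z. \<Sum>a\<in>supp r. r a z * h (n - a) z)"

definition deltaH :: "gr \<Rightarrow> gr" where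
  "deltaH h = (\<lambda>m. Dser (m - 2) (h (m - 2)))"

text \<open>Endomorphisms are represented as maps on gr sending everything outside H to 0,
  so that HOL equality coincides with equality as maps on H.\<close>
definition restr :: "(gr \<Rightarrow> gr) \<Rightarrow> gr \<Rightarrow> gr" where
  "restr A = (\<lambda>h. if h \<in> Hcar then A h else (\<lambda>_ _. 0))"

definition idH :: "gr \<Rightarrow> gr" where
  "idH = restr id"

definition delta_op :: "gr \<Rightarrow> gr" where
  "delta_op = restr deltaH"

definition e4 :: "gr \<Rightarrow> gr" where
  "e4 = restr (grmult (hom 4 E4))"

definition e6 :: "gr \<Rightarrow> gr" where
  "e6 = restr (grmult (hom 6 E6))"

definition radd :: "(gr \<Rightarrow> gr) \<Rightarrow> (gr \<Rightarrow> gr) \<Rightarrow> gr \<Rightarrow> gr" where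
  "radd A B = (\<lambda>h n z. A h n z + B h n z)"

definition rscale :: "complex \<Rightarrow> (gr \<Rightarrow> gr) \<Rightarrow> gr \<Rightarrow> gr" where
  "rscale c A = (\<lambda>h n z. c * A h n z)"

inductive_set Ralg :: "(gr \<Rightarrow> gr) set" where
  R_delta: "delta_op \<in> Ralg"
| R_e4: "e4 \<in> Ralg"
| R_e6: "e6 \<in> Ralg"
| R_one: "idH \<in> Ralg"
| R_add: "A \<in> Ralg \<Longrightarrow> B \<in> Ralg \<Longrightarrow> radd A B \<in> Ralg"
| R_scale: "A \<in> Ralg \<Longrightarrow> rscale c A \<in> Ralg"
| R_mult: "A \<in> Ralg \<Longrightarrow> B \<in> Ralg \<Longrightarrow> A \<circ> B \<in> Ralg"

definition rmono :: "nat \<Rightarrow> nat \<Rightarrow> nat \<Rightarrow> gr \<Rightarrow> gr" where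
  "rmono i j k = (e4 ^^ i) \<circ> (e6 ^^ j) \<circ> (delta_op ^^ k) \<circ> idH"

section \<open>The graded ring M of level one modular forms, as the direct sum of the M_k\<close>

definition wts :: "real \<Rightarrow> (nat \<times> nat) set" where
  "wts k = {(i, j). real (4 * i + 6 * j) = k}"

definition Mk :: "real \<Rightarrow> (complex \<Rightarrow> complex) set" where
  "Mk k = {f. \<exists>c :: nat \<times> nat \<Rightarrow> complex.
              f = onH (\<lambda>z. \<Sum>p\<in>wts k. c p * E4 z ^ fst p * E6 z ^ snd p)}"

definition Mcar :: "gr set" where
  "Mcar = {h \<in> Hcar. \<forall>k. h k \<in> Mk k}"

type_synonym skew = "nat \<Rightarrow> gr"

definition Skew :: "skew set" where
  "Skew = {p. finite {k. p k \<noteq> (\<lambda>_ _. 0)} \<and> (\<forall>k. p k \<in> Mcar)}"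

definition ssupp :: "skew \<Rightarrow> nat set" where
  "ssupp p = {k. p k \<noteq> (\<lambda>_ _. 0)}"

definition skew_add :: "skew \<Rightarrow> skew \<Rightarrow> skew" where
  "skew_add p q = (\<lambda>k n z. p k n z + q k n z)"

definition skew_scale :: "complex \<Rightarrow> skew \<Rightarrow> skew" where
  "skew_scale c p = (\<lambda>k n z. c * p k n z)"

text \<open>(r xi^a)(s xi^b) = sum_i (a choose i) r delta^i(s) xi^(a+b-i), i.e. the
  multiplication determined by xi r = r xi + delta(r).\<close>
definition skew_mult :: "skew \<Rightarrow> skew \<Rightarrow> skew" where
  "skew_mult p q = (\<lambda>m n z.
     \<Sum>(a, b, i)\<in>{(a, b, i). a \<in> ssupp p \<and> b \<in> ssupp q \<and> i \<le> a \<and> a + b - i = m}.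
       of_nat (a choose i) * grmult (p a) ((deltaH ^^ i) (q b)) n z)"

definition skew_one :: skew where
  "skew_one = (\<lambda>k. if k = 0 then hom 0 (onH (\<lambda>_. 1)) else (\<lambda>_ _. 0))"

definition skew_mono :: "nat \<Rightarrow> nat \<Rightarrow> nat \<Rightarrow> skew" where
  "skew_mono i j k = (\<lambda>m. if m = k
       then hom (real (4 * i + 6 * j)) (onH (\<lambda>z. E4 z ^ i * E6 z ^ j))
       else (\<lambda>_ _. 0))"

end

theory Submission
  imports Defs "HOL-Complex_Analysis.Cauchy_Integral_Formula"
begin

text \<open>An element \<open>\<Sum> p\<^sub>k \<xi>\<^sup>k\<close> of the skew polynomial ring acts on \<open>H\<close> by
  \<open>h \<mapsto> \<Sum> p\<^sub>k \<delta>\<^sup>k h\<close>. Since \<open>\<delta>\<close> is a derivation of \<open>H\<close>, the Leibniz rule makes this action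
  multiplicative, and it sends monomials to monomials, which gives surjectivity. Applied to a
  function vanishing at a point \<open>z\<^sub>0\<close> to order exactly the degree in \<open>\<xi>\<close>, only the leading
  term survives at \<open>z\<^sub>0\<close>; as \<open>z\<^sub>0\<close> is arbitrary, the action is faithful.

  The arithmetic input is that \<open>\<delta>\<close> preserves \<open>M\<close>, i.e. Ramanujan's identities for the
  derivatives of \<open>E\<^sub>4\<close> and \<open>E\<^sub>6\<close>. These are convolution identities for divisor
  sums, that is, for sums of polynomials \<open>f(a, b)\<close> over the positive solutions of
  \<open>ax + by = n\<close>. They follow from comparing \<open>f(a, b)\<close> with \<open>f(a, a + b)\<close> for those \<open>f\<close> for
  which both are symmetric, such as powers of \<open>a\<^sup>2 - ab + b\<^sup>2\<close>.\<close>

section \<open>Divisor sum convolutions\<close>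

text \<open>For \<open>m = a * x\<close>, a quadruple records a divisor \<open>a\<close> of
  \<open>m\<close>, a divisor \<open>b\<close> of \<open>n - m\<close> and both cofactors; keeping
  the cofactors is what makes the bijections below expressible.\<close>

definition conv_set :: "nat \<Rightarrow> (nat \<times> nat \<times> nat \<times> nat) set" where
  "conv_set n = {(a, b, x, y). 0 < a \<and> 0 < b \<and> 0 < x \<and> 0 < y \<and> a * x + b * y = n}"

lemma finite_conv_set: "finite (conv_set n)"
proof (rule finite_subset)
  show "conv_set n \<subseteq> {..n} \<times> {..n} \<times> {..n} \<times> {..n}"
  proof
    fix t assume "t \<in> conv_set n"
    then obtain a b x y where t: "t = (a, b, x, y)" "0 < a" "0 < b" "0 < x" "0 < y"
        "a * x + b * y = n"
      by (auto simp: conv_set_def)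
    then have "a \<le> n" "b \<le> n" "x \<le> n" "y \<le> n"
      by (auto intro: trans_le_add1 trans_le_add2)
    then show "t \<in> {..n} \<times> {..n} \<times> {..n} \<times> {..n}" using t by auto
  qed
qed simp

text \<open>The involution swapping \<open>(a, x)\<close> with \<open>(b, y)\<close> folds a symmetric sum in two along
  \<open>a = b\<close> and along \<open>x = y\<close>, and \<open>(a, b, x, y) \<mapsto> (a, a + b, x - y, y)\<close> maps the
  half \<open>y < x\<close> onto the half \<open>a < b\<close>.\<close>

lemma conv_set_sum_symmetric:
  fixes f g :: "nat \<Rightarrow> nat \<Rightarrow> 'a::comm_ring_1"
  assumes f: "\<And>a b. f a b = f b a" and g: "\<And>a b. g a b = g b a"
    and fg: "\<And>a b. g a b = f a (a + b)" and n: "0 < n"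
  shows "(\<Sum>(a, b, x, y)\<in>conv_set n. f a b) - (\<Sum>(a, b, x, y)\<in>conv_set n. g a b) =
    (\<Sum>d | d dvd n. (of_nat (n div d) - 1) * f d d) -
    (\<Sum>d | d dvd n. \<Sum>a = 1..<d. g a (d - a))"
proof -
  let ?S = "conv_set n"
  let ?lt = "{(a, b, x, y)\<in>?S. a < b}" and ?gt = "{(a, b, x, y)\<in>?S. b < a}"
  let ?eq = "{(a, b, x, y)\<in>?S. a = b}"
  let ?lt' = "{(a, b, x, y)\<in>?S. y < x}" and ?gt' = "{(a, b, x, y)\<in>?S. x < y}"
  let ?eq' = "{(a, b, x, y)\<in>?S. x = y}"
  have fin: "finite T" if "T \<subseteq> ?S" for T
    using that finite_conv_set finite_subset by blast
  have split1: "(\<Sum>(a, b, x, y)\<in>?S. f a b) =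
      (\<Sum>(a, b, x, y)\<in>?lt. f a b) + (\<Sum>(a, b, x, y)\<in>?gt. f a b) + (\<Sum>(a, b, x, y)\<in>?eq. f a b)"
  proof -
    have "?S = (?lt \<union> ?gt) \<union> ?eq" by auto
    then have "(\<Sum>(a, b, x, y)\<in>?S. f a b) = (\<Sum>(a, b, x, y)\<in>(?lt \<union> ?gt) \<union> ?eq. f a b)" by simp
    also have "\<dots> = (\<Sum>(a, b, x, y)\<in>?lt \<union> ?gt. f a b) + (\<Sum>(a, b, x, y)\<in>?eq. f a b)"
      by (rule sum.union_disjoint) (auto intro: fin)
    also have "(\<Sum>(a, b, x, y)\<in>?lt \<union> ?gt. f a b) =
      (\<Sum>(a, b, x, y)\<in>?lt. f a b) + (\<Sum>(a, b, x, y)\<in>?gt. f a b)"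
      by (rule sum.union_disjoint) (auto intro: fin)
    finally show ?thesis .
  qed
  have split2: "(\<Sum>(a, b, x, y)\<in>?S. g a b) =
      (\<Sum>(a, b, x, y)\<in>?lt'. g a b) + (\<Sum>(a, b, x, y)\<in>?gt'. g a b) + (\<Sum>(a, b, x, y)\<in>?eq'. g a b)"
  proof -
    have "?S = (?lt' \<union> ?gt') \<union> ?eq'" by auto
    then have "(\<Sum>(a, b, x, y)\<in>?S. g a b) = (\<Sum>(a, b, x, y)\<in>(?lt' \<union> ?gt') \<union> ?eq'. g a b)" by simp
    also have "\<dots> = (\<Sum>(a, b, x, y)\<in>?lt' \<union> ?gt'. g a b) + (\<Sum>(a, b, x, y)\<in>?eq'. g a b)"
      by (rule sum.union_disjoint) (auto intro: fin)
    also have "(\<Sum>(a, b, x, y)\<in>?lt' \<union> ?gt'. g a b) =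
      (\<Sum>(a, b, x, y)\<in>?lt'. g a b) + (\<Sum>(a, b, x, y)\<in>?gt'. g a b)"
      by (rule sum.union_disjoint) (auto intro: fin)
    finally show ?thesis .
  qed
  let ?sw = "\<lambda>(a, b, x, y). (b, a, y, x) :: nat \<times> nat \<times> nat \<times> nat"
  have gt: "(\<Sum>(a, b, x, y)\<in>?gt. f a b) = (\<Sum>(a, b, x, y)\<in>?lt. f a b)"
    by (rule sum.reindex_bij_witness[of _ ?sw ?sw]) (auto simp: conv_set_def f add.commute)
  have gt': "(\<Sum>(a, b, x, y)\<in>?gt'. g a b) = (\<Sum>(a, b, x, y)\<in>?lt'. g a b)"
    by (rule sum.reindex_bij_witness[of _ ?sw ?sw]) (auto simp: conv_set_def g add.commute)
  \<comment> \<open>These two identities show that the shear and its inverse preserve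
    \<open>a * x + b * y\<close>.\<close>
  have "a * (x - y) + (a + b) * y = a * x + b * y" if "y < x" for a b x y :: nat
    using that by (auto simp: algebra_simps dest!: less_imp_Suc_add)
  moreover have "a * (x + y) + (b - a) * y = a * x + b * y" if "a < b" for a b x y :: nat
    using that by (auto simp: algebra_simps dest!: less_imp_Suc_add)
  ultimately have "(\<Sum>(a, b, x, y)\<in>?lt'. g a b) = (\<Sum>(a, b, x, y)\<in>?lt. f a b)"
    by (intro sum.reindex_bij_witness[of _ "\<lambda>(a, b, x, y). (a, b - a, x + y, y)"
          "\<lambda>(a, b, x, y). (a, a + b, x - y, y)"])
       (auto simp: conv_set_def fg)
  \<comment> \<open>For \<open>a = b = d\<close> the equation reads \<open>d * (x + y) = n\<close>,
    so \<open>x\<close> determines \<open>y\<close> and takes \<open>n div d - 1\<close>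
    values.\<close>
  moreover have "(\<Sum>(a, b, x, y)\<in>?eq. f a b) = (\<Sum>d | d dvd n. (of_nat (n div d) - 1) * f d d)"
  proof -
    have "(\<Sum>(a, b, x, y)\<in>?eq. f a b) = (\<Sum>(d, x)\<in>(SIGMA d:{d. d dvd n}. {1..<n div d}). f d d)"
    proof (rule sum.reindex_bij_witness[of _ "\<lambda>(d, x). (d, d, x, n div d - x)" "\<lambda>(a, b, x, y). (a, x)"])
      fix t assume "t \<in> (SIGMA d:{d. d dvd n}. {1..<n div d})"
      then obtain d x where t: "t = (d, x)" "d dvd n" "1 \<le> x" "x < n div d" by auto
      then have "d * x + d * (n div d - x) = n"
        by (simp add: distrib_left[symmetric])
      then show "(case t of (d, x) \<Rightarrow> (d, d, x, n div d - x)) \<in> ?eq"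
        using t n by (auto simp: conv_set_def intro!: Nat.gr0I)
    next
      fix t assume "t \<in> ?eq"
      then obtain a x y where t: "t = (a, a, x, y)" "0 < a" "0 < x" "0 < y" "n = a * (x + y)"
        by (auto simp: conv_set_def distrib_left)
      then show "(case t of (a, b, x, y) \<Rightarrow> (a, x)) \<in> (SIGMA d:{d. d dvd n}. {1..<n div d})"
        and "(case (case t of (a, b, x, y) \<Rightarrow> (a, x)) of (d, x) \<Rightarrow> (d, d, x, n div d - x)) = t"
        and "(case (case t of (a, b, x, y) \<Rightarrow> (a, x)) of (d, x) \<Rightarrow> f d d) = (case t of (a, b, x, y) \<Rightarrow> f a b)"
        by auto
    qed auto
    also have "\<dots> = (\<Sum>d | d dvd n. \<Sum>x = 1..<n div d. f d d)"
      by (rule sum.Sigma[symmetric]) (auto simp: finite_divisors_nat n)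
    also have "\<dots> = (\<Sum>d | d dvd n. (of_nat (n div d) - 1) * f d d)"
    proof (intro sum.cong refl)
      fix d assume "d \<in> {d. d dvd n}"
      then have "1 \<le> n div d" using n by (auto elim!: dvdE)
      then show "(\<Sum>x = 1..<n div d. f d d) = (of_nat (n div d) - 1) * f d d"
        by (simp add: of_nat_diff)
    qed
    finally show ?thesis .
  qed
  \<comment> \<open>For \<open>x = y\<close> the equation reads \<open>(a + b) * x = n\<close>, so
    the solutions are the ways to split a divisor \<open>d\<close> of \<open>n\<close> as
    \<open>a + b\<close>.\<close>
  moreover have "(\<Sum>(a, b, x, y)\<in>?eq'. g a b) = (\<Sum>d | d dvd n. \<Sum>a = 1..<d. g a (d - a))"
  proof -
    have "(\<Sum>(a, b, x, y)\<in>?eq'. g a b) = (\<Sum>(d, a)\<in>(SIGMA d:{d. d dvd n}. {1..<d}). g a (d - a))"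
    proof (rule sum.reindex_bij_witness[of _ "\<lambda>(d, a). (a, d - a, n div d, n div d)" "\<lambda>(a, b, x, y). (a + b, a)"])
      fix t assume "t \<in> (SIGMA d:{d. d dvd n}. {1..<d})"
      then obtain d a where t: "t = (d, a)" "d dvd n" "1 \<le> a" "a < d" by auto
      then have "a * (n div d) + (d - a) * (n div d) = n"
        by (simp add: distrib_right[symmetric])
      moreover have "0 < n div d" using t n by (auto elim!: dvdE)
      ultimately show "(case t of (d, a) \<Rightarrow> (a, d - a, n div d, n div d)) \<in> ?eq'"
        using t n by (auto simp: conv_set_def)
    next
      fix t assume "t \<in> ?eq'"
      then obtain a b x where t: "t = (a, b, x, x)" "0 < a" "0 < b" "0 < x" "n = (a + b) * x"
        by (auto simp: conv_set_def distrib_right)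
      then show "(case t of (a, b, x, y) \<Rightarrow> (a + b, a)) \<in> (SIGMA d:{d. d dvd n}. {1..<d})"
        and "(case (case t of (a, b, x, y) \<Rightarrow> (a + b, a)) of (d, a) \<Rightarrow> (a, d - a, n div d, n div d)) = t"
        and "(case (case t of (a, b, x, y) \<Rightarrow> (a + b, a)) of (d, a) \<Rightarrow> g a (d - a)) = (case t of (a, b, x, y) \<Rightarrow> g a b)"
        by auto
    qed auto
    also have "\<dots> = (\<Sum>d | d dvd n. \<Sum>a = 1..<d. g a (d - a))"
      by (rule sum.Sigma[symmetric]) (auto simp: finite_divisors_nat n)
    finally show ?thesis .
  qed
  ultimately show ?thesis using split1 split2 gt gt' by simp
qed

text \<open>Every natural number divides 0, so the defining sum runs over an infinite set and takes
  the default value 0. The generating series therefore start at \<open>n = 1\<close>.\<close>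

lemma divsigma_0 [simp]: "divsigma k 0 = 0"
  by (simp add: divsigma_def)

text \<open>Divisors \<open>a\<close> of \<open>m\<close> and \<open>b\<close> of
  \<open>n - m\<close> amount to a point of \<open>conv_set n\<close>, with cofactors
  \<open>m div a\<close> and \<open>(n - m) div b\<close>; the end terms \<open>m = 0\<close> and
  \<open>m = n\<close> vanish.\<close>

lemma divsigma_convolution:
  "(\<Sum>m = 0..n. divsigma i m * divsigma j (n - m)) =
     (\<Sum>(a, b, x, y)\<in>conv_set n. of_nat a ^ i * of_nat b ^ j)"
proof -
  have "(\<Sum>m = 0..n. divsigma i m * divsigma j (n - m)) =
      (\<Sum>m = 1..<n. divsigma i m * divsigma j (n - m))"
    by (rule sum.mono_neutral_right) (auto simp: not_less_eq_eq not_less)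
  also have "\<dots> = (\<Sum>m = 1..<n. \<Sum>(a, b)\<in>{a. a dvd m} \<times> {b. b dvd n - m}. of_nat a ^ i * of_nat b ^ j)"
    by (simp add: divsigma_def sum_product sum.cartesian_product)
  also have "\<dots> = (\<Sum>(m, a, b)\<in>(SIGMA m:{1..<n}. {a. a dvd m} \<times> {b. b dvd n - m}). of_nat a ^ i * of_nat b ^ j)"
    by (subst sum.Sigma) (auto simp: finite_divisors_nat)
  also have "\<dots> = (\<Sum>(a, b, x, y)\<in>conv_set n. of_nat a ^ i * of_nat b ^ j)"
  proof (rule sum.reindex_bij_witness[of _ "\<lambda>(a, b, x, y). (a * x, a, b)"
        "\<lambda>(m, a, b). (a, b, m div a, (n - m) div b)"])
    fix t assume "t \<in> (SIGMA m:{1..<n}. {a. a dvd m} \<times> {b. b dvd n - m})"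
    then obtain m a b where t: "t = (m, a, b)" "1 \<le> m" "m < n" "a dvd m" "b dvd n - m" by auto
    then obtain x y where xy: "m = a * x" "n - m = b * y" by (auto elim!: dvdE)
    then have pos: "0 < a" "0 < x" "0 < b" "0 < y" using t by (auto intro!: Nat.gr0I)
    have "n = a * x + b * y" using xy t by simp
    then show "(case t of (m, a, b) \<Rightarrow> (a, b, m div a, (n - m) div b)) \<in> conv_set n"
      and "(case (case t of (m, a, b) \<Rightarrow> (a, b, m div a, (n - m) div b)) of (a, b, x, y) \<Rightarrow> (a * x, a, b)) = t"
      and "(case (case t of (m, a, b) \<Rightarrow> (a, b, m div a, (n - m) div b)) of (a, b, x, y) \<Rightarrow> of_nat a ^ i * of_nat b ^ j)
        = (case t of (m, a, b) \<Rightarrow> of_nat a ^ i * (of_nat b ^ j :: complex))"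
      using t xy pos by (auto simp: conv_set_def)
  next
    fix t assume "t \<in> conv_set n"
    then obtain a b x y where t: "t = (a, b, x, y)" "0 < a" "0 < b" "0 < x" "0 < y" "n = a * x + b * y"
      by (auto simp: conv_set_def)
    then show "(case t of (a, b, x, y) \<Rightarrow> (a * x, a, b)) \<in> (SIGMA m:{1..<n}. {a. a dvd m} \<times> {b. b dvd n - m})"
      and "(case (case t of (a, b, x, y) \<Rightarrow> (a * x, a, b)) of (m, a, b) \<Rightarrow> (a, b, m div a, (n - m) div b)) = t"
      by auto
  qed
  finally show ?thesis .
qed

section \<open>Closed forms for power sums\<close>

lemma sum_eq_telescope:
  fixes F :: "nat \<Rightarrow> 'a::comm_monoid_add"
  assumes "F 1 = 0" "\<And>n. 1 \<le> n \<Longrightarrow> F (Suc n) = F n + f n" "1 \<le> N"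
  shows "(\<Sum>a = 1..<N. f a) = F N"
  using assms(3) by (induction N rule: dec_induct) (use assms(1,2) in auto)

text \<open>Faulhaber's formulas, verified through their difference equations in \<open>N\<close>.
  The sums stop at \<open>N - 1\<close>, hence the minus sign of the second term in positive
  degree.\<close>

lemma sum_powers_le_6:
  fixes N :: nat
  assumes "1 \<le> N"
  shows "(\<Sum>a = 1..<N. of_nat a ^ 0) = (of_nat N - 1 :: 'a::field_char_0)"
    and "(\<Sum>a = 1..<N. of_nat a ^ 1) = (of_nat N ^ 2 / 2 - of_nat N / 2 :: 'a)"
    and "(\<Sum>a = 1..<N. of_nat a ^ 2) = (of_nat N ^ 3 / 3 - of_nat N ^ 2 / 2 + of_nat N / 6 :: 'a)"
    and "(\<Sum>a = 1..<N. of_nat a ^ 3) = (of_nat N ^ 4 / 4 - of_nat N ^ 3 / 2 + of_nat N ^ 2 / 4 :: 'a)"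
    and "(\<Sum>a = 1..<N. of_nat a ^ 4) =
      (of_nat N ^ 5 / 5 - of_nat N ^ 4 / 2 + of_nat N ^ 3 / 3 - of_nat N / 30 :: 'a)"
    and "(\<Sum>a = 1..<N. of_nat a ^ 5) =
      (of_nat N ^ 6 / 6 - of_nat N ^ 5 / 2 + 5 * of_nat N ^ 4 / 12 - of_nat N ^ 2 / 12 :: 'a)"
    and "(\<Sum>a = 1..<N. of_nat a ^ 6) =
      (of_nat N ^ 7 / 7 - of_nat N ^ 6 / 2 + of_nat N ^ 5 / 2 - of_nat N ^ 3 / 6 + of_nat N / 42 :: 'a)"
  by (rule sum_eq_telescope[OF _ _ assms]; simp add: field_simps eval_nat_numeral)+

text \<open>The coefficients are constant in \<open>a\<close> but may involve \<open>N\<close>, as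
  they do after the substitution \<open>b = d - a\<close> below.\<close>

lemma sum_poly_le_6:
  fixes N :: nat and c0 c1 c2 c3 c4 c5 c6 :: "'a::field_char_0"
  assumes "1 \<le> N"
    and "\<And>a. a < N \<Longrightarrow> p a = c0 * of_nat a ^ 0 + c1 * of_nat a ^ 1 + c2 * of_nat a ^ 2
      + c3 * of_nat a ^ 3 + c4 * of_nat a ^ 4 + c5 * of_nat a ^ 5 + c6 * of_nat a ^ 6"
  shows "(\<Sum>a = 1..<N. p a) = c0 * (of_nat N - 1) + c1 * (of_nat N ^ 2 / 2 - of_nat N / 2)
    + c2 * (of_nat N ^ 3 / 3 - of_nat N ^ 2 / 2 + of_nat N / 6)
    + c3 * (of_nat N ^ 4 / 4 - of_nat N ^ 3 / 2 + of_nat N ^ 2 / 4)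
    + c4 * (of_nat N ^ 5 / 5 - of_nat N ^ 4 / 2 + of_nat N ^ 3 / 3 - of_nat N / 30)
    + c5 * (of_nat N ^ 6 / 6 - of_nat N ^ 5 / 2 + 5 * of_nat N ^ 4 / 12 - of_nat N ^ 2 / 12)
    + c6 * (of_nat N ^ 7 / 7 - of_nat N ^ 6 / 2 + of_nat N ^ 5 / 2 - of_nat N ^ 3 / 6 + of_nat N / 42)"
proof -
  have "(\<Sum>a = 1..<N. p a) = (\<Sum>a = 1..<N. c0 * of_nat a ^ 0 + c1 * of_nat a ^ 1 + c2 * of_nat a ^ 2
      + c3 * of_nat a ^ 3 + c4 * of_nat a ^ 4 + c5 * of_nat a ^ 5 + c6 * of_nat a ^ 6)"
    by (intro sum.cong) (auto simp: assms(2))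
  also have "\<dots> = c0 * (\<Sum>a = 1..<N. of_nat a ^ 0) + c1 * (\<Sum>a = 1..<N. of_nat a ^ 1)
      + c2 * (\<Sum>a = 1..<N. of_nat a ^ 2) + c3 * (\<Sum>a = 1..<N. of_nat a ^ 3)
      + c4 * (\<Sum>a = 1..<N. of_nat a ^ 4) + c5 * (\<Sum>a = 1..<N. of_nat a ^ 5)
      + c6 * (\<Sum>a = 1..<N. of_nat a ^ 6)"
    unfolding sum.distrib sum_distrib_left by (rule refl)
  finally show ?thesis unfolding sum_powers_le_6[OF assms(1)] .
qed

section \<open>Generating series of divisor sums and their convolution identities\<close>

definition divsigma_fps :: "nat \<Rightarrow> complex fps" where
  "divsigma_fps k = Abs_fps (divsigma k)"

lemma divsigma_fps_nth [simp]: "fps_nth (divsigma_fps k) n = divsigma k n"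
  by (simp add: divsigma_fps_def)

lemma divsigma_fps_mult_nth:
  "fps_nth (divsigma_fps i * divsigma_fps j) n =
     (\<Sum>(a, b, x, y)\<in>conv_set n. of_nat a ^ i * of_nat b ^ j)"
  by (simp add: fps_mult_nth divsigma_convolution)

text \<open>The factor \<open>n\<close> created here becomes the effect of \<open>q d/dq\<close> on
  coefficients.\<close>

lemma of_nat_div_mult_power:
  assumes "d dvd n" "0 < d"
  shows "of_nat (n div d) * of_nat d ^ Suc k = (of_nat n * of_nat d ^ k :: complex)"
  using assms by (auto elim!: dvdE)

text \<open>With \<open>u = a^2 + b^2\<close> and \<open>v = a b\<close>, the polynomials are
  \<open>f = (u - v)^2\<close> and \<open>g = (u + v)^2\<close>; their difference
  \<open>-4 u v\<close> is a multiple of \<open>a b^3 + a^3 b\<close>.\<close>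

lemma divsigma_convolution_1_3:
  assumes n: "0 < n"
  shows "240 * fps_nth (divsigma_fps 1 * divsigma_fps 3) n =
    21 * divsigma 5 n + (10 - 30 * of_nat n) * divsigma 3 n - divsigma 1 n"
proof -
  define f g :: "nat \<Rightarrow> nat \<Rightarrow> complex"
    where "f = (\<lambda>a b. (of_nat a ^ 2 - of_nat a * of_nat b + of_nat b ^ 2) ^ 2)"
      and "g = (\<lambda>a b. (of_nat a ^ 2 + of_nat a * of_nat b + of_nat b ^ 2) ^ 2)"
  have X: "(\<Sum>a = 1..<d. g a (d - a)) =
      7 / 10 * of_nat d ^ 5 - of_nat d ^ 4 + of_nat d ^ 3 / 3 - of_nat d / 30" if "1 \<le> d" for d
  proof -
    \<comment> \<open>Putting \<open>b = d - a\<close> turns \<open>a^2 + a b + b^2\<close> into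
      \<open>a^2 - a d + d^2\<close>; the coefficients listed are those of its square.\<close>
    have "(\<Sum>a = 1..<d. g a (d - a)) = of_nat d ^ 4 * (of_nat d - 1)
        + (- 2 * of_nat d ^ 3) * (of_nat d ^ 2 / 2 - of_nat d / 2)
        + (3 * of_nat d ^ 2) * (of_nat d ^ 3 / 3 - of_nat d ^ 2 / 2 + of_nat d / 6)
        + (- 2 * of_nat d) * (of_nat d ^ 4 / 4 - of_nat d ^ 3 / 2 + of_nat d ^ 2 / 4)
        + 1 * (of_nat d ^ 5 / 5 - of_nat d ^ 4 / 2 + of_nat d ^ 3 / 3 - of_nat d / 30)
        + 0 * (of_nat d ^ 6 / 6 - of_nat d ^ 5 / 2 + 5 * of_nat d ^ 4 / 12 - of_nat d ^ 2 / 12)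
        + 0 * (of_nat d ^ 7 / 7 - of_nat d ^ 6 / 2 + of_nat d ^ 5 / 2 - of_nat d ^ 3 / 6 + of_nat d / 42)"
      by (rule sum_poly_le_6[OF that])
         (simp add: g_def of_nat_diff algebra_simps eval_nat_numeral)
    then show ?thesis by (simp add: algebra_simps eval_nat_numeral)
  qed
  have "(\<Sum>(a, b, x, y)\<in>conv_set n. f a b) - (\<Sum>(a, b, x, y)\<in>conv_set n. g a b) =
      (\<Sum>(a, b, x, y)\<in>conv_set n. - 4 * (of_nat a ^ 1 * of_nat b ^ 3) - 4 * (of_nat a ^ 3 * of_nat b ^ 1))"
    unfolding sum_subtractf[symmetric]
    by (intro sum.cong) (auto simp: f_def g_def algebra_simps eval_nat_numeral)
  also have "\<dots> = - 8 * fps_nth (divsigma_fps 1 * divsigma_fps 3) n"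
    using divsigma_fps_mult_nth[of 3 1 n] divsigma_fps_mult_nth[of 1 3 n]
    by (simp add: case_prod_unfold sum_subtractf sum_distrib_left[symmetric] sum_negf
        mult.commute[of "divsigma_fps 3"])
  finally have "- 8 * fps_nth (divsigma_fps 1 * divsigma_fps 3) n =
      (\<Sum>(a, b, x, y)\<in>conv_set n. f a b) - (\<Sum>(a, b, x, y)\<in>conv_set n. g a b)" ..
  also have "\<dots> = (\<Sum>d | d dvd n. (of_nat (n div d) - 1) * f d d) -
      (\<Sum>d | d dvd n. \<Sum>a = 1..<d. g a (d - a))"
    by (rule conv_set_sum_symmetric)
       (auto simp: f_def g_def n algebra_simps eval_nat_numeral)
  also have "\<dots> = (\<Sum>d | d dvd n. of_nat n * of_nat d ^ 3 - 7 / 10 * of_nat d ^ 5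
      - 1 / 3 * of_nat d ^ 3 + 1 / 30 * of_nat d ^ 1)"
    unfolding sum_subtractf[symmetric]
  proof (intro sum.cong refl)
    fix d assume "d \<in> {d. d dvd n}"
    then have d: "d dvd n" "1 \<le> d" using n by (auto intro!: Suc_leI Nat.gr0I)
    have "f d d = of_nat d ^ 4" by (simp add: f_def eval_nat_numeral)
    \<comment> \<open>The terms in \<open>d ^ 4\<close> cancel, so only odd power sums over divisors
      survive.\<close>
    then show "(of_nat (n div d) - 1) * f d d - (\<Sum>a = 1..<d. g a (d - a)) =
      of_nat n * of_nat d ^ 3 - 7 / 10 * of_nat d ^ 5 - 1 / 3 * of_nat d ^ 3 + 1 / 30 * of_nat d ^ 1"
      using of_nat_div_mult_power[of d n 3] d X[of d] by (simp add: left_diff_distrib)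
  qed
  also have "\<dots> = of_nat n * divsigma 3 n - 7 / 10 * divsigma 5 n - 1 / 3 * divsigma 3 n
      + 1 / 30 * divsigma 1 n"
    unfolding divsigma_def sum_distrib_left sum_subtractf sum.distrib by (rule refl)
  finally show ?thesis by (simp add: field_simps)
qed

text \<open>The coefficients 249 and \<open>-14\<close> below produce the combination of
  \<open>\<sigma>\<^sub>1 * \<sigma>\<^sub>5\<close> and \<open>\<sigma>\<^sub>3 * \<sigma>\<^sub>3\<close> that occurs in \<open>E\<^sub>2 E\<^sub>6 - E\<^sub>4\<^sup>2\<close>.\<close>

lemma divsigma_convolution_1_5_3_3:
  assumes n: "0 < n"
  shows "168 * fps_nth (divsigma_fps 1 * divsigma_fps 5) n =
    800 * fps_nth (divsigma_fps 3 * divsigma_fps 3) n + (7 - 14 * of_nat n) * divsigma 5 n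
    + 20 / 3 * divsigma 3 n + 1 / 3 * divsigma 1 n"
proof -
  define f g :: "nat \<Rightarrow> nat \<Rightarrow> complex"
    \<comment> \<open>Besides the cube of \<open>a^2 - a b + b^2\<close>, the sextic
      \<open>a^2 b^2 (a - b)^2\<close> also stays symmetric when \<open>b\<close> becomes
      \<open>a + b\<close>: it turns into \<open>a^2 b^2 (a + b)^2\<close>.\<close>
    where "f = (\<lambda>a b. 249 * of_nat a ^ 2 * of_nat b ^ 2 * (of_nat a - of_nat b) ^ 2
        - 14 * (of_nat a ^ 2 - of_nat a * of_nat b + of_nat b ^ 2) ^ 3)"
      and "g = (\<lambda>a b. 249 * of_nat a ^ 2 * of_nat b ^ 2 * (of_nat a + of_nat b) ^ 2
        - 14 * (of_nat a ^ 2 + of_nat a * of_nat b + of_nat b ^ 2) ^ 3)"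
  have X: "(\<Sum>a = 1..<d. g a (d - a)) =
      14 * of_nat d ^ 6 - 7 * of_nat d ^ 5 - 20 / 3 * of_nat d ^ 3 - 1 / 3 * of_nat d" if "1 \<le> d" for d
  proof -
    have "(\<Sum>a = 1..<d. g a (d - a)) = (- 14 * of_nat d ^ 6) * (of_nat d - 1)
        + (42 * of_nat d ^ 5) * (of_nat d ^ 2 / 2 - of_nat d / 2)
        + (165 * of_nat d ^ 4) * (of_nat d ^ 3 / 3 - of_nat d ^ 2 / 2 + of_nat d / 6)
        + (- 400 * of_nat d ^ 3) * (of_nat d ^ 4 / 4 - of_nat d ^ 3 / 2 + of_nat d ^ 2 / 4)
        + (165 * of_nat d ^ 2) * (of_nat d ^ 5 / 5 - of_nat d ^ 4 / 2 + of_nat d ^ 3 / 3 - of_nat d / 30)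
        + (42 * of_nat d) * (of_nat d ^ 6 / 6 - of_nat d ^ 5 / 2 + 5 * of_nat d ^ 4 / 12 - of_nat d ^ 2 / 12)
        + (- 14) * (of_nat d ^ 7 / 7 - of_nat d ^ 6 / 2 + of_nat d ^ 5 / 2 - of_nat d ^ 3 / 6 + of_nat d / 42)"
      by (rule sum_poly_le_6[OF that])
         (simp add: g_def of_nat_diff algebra_simps eval_nat_numeral)
    then show ?thesis by (simp add: algebra_simps eval_nat_numeral)
  qed
  have "(\<Sum>(a, b, x, y)\<in>conv_set n. f a b) - (\<Sum>(a, b, x, y)\<in>conv_set n. g a b) =
      (\<Sum>(a, b, x, y)\<in>conv_set n. 84 * (of_nat a ^ 1 * of_nat b ^ 5) + 84 * (of_nat a ^ 5 * of_nat b ^ 1)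
        - 800 * (of_nat a ^ 3 * of_nat b ^ 3))"
    unfolding sum_subtractf[symmetric]
    by (intro sum.cong) (auto simp: f_def g_def algebra_simps eval_nat_numeral)
  also have "\<dots> = 168 * fps_nth (divsigma_fps 1 * divsigma_fps 5) n
      - 800 * fps_nth (divsigma_fps 3 * divsigma_fps 3) n"
    using divsigma_fps_mult_nth[of 5 1 n] divsigma_fps_mult_nth[of 1 5 n] divsigma_fps_mult_nth[of 3 3 n]
    by (simp add: case_prod_unfold sum_subtractf sum.distrib sum_distrib_left[symmetric]
        mult.commute[of "divsigma_fps 5"])
  finally have "168 * fps_nth (divsigma_fps 1 * divsigma_fps 5) n
      - 800 * fps_nth (divsigma_fps 3 * divsigma_fps 3) n =
      (\<Sum>(a, b, x, y)\<in>conv_set n. f a b) - (\<Sum>(a, b, x, y)\<in>conv_set n. g a b)" ..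
  also have "\<dots> = (\<Sum>d | d dvd n. (of_nat (n div d) - 1) * f d d) -
      (\<Sum>d | d dvd n. \<Sum>a = 1..<d. g a (d - a))"
    by (rule conv_set_sum_symmetric)
       (auto simp: f_def g_def n algebra_simps eval_nat_numeral)
  also have "\<dots> = (\<Sum>d | d dvd n. 7 * of_nat d ^ 5 - 14 * (of_nat n * of_nat d ^ 5)
      + 20 / 3 * of_nat d ^ 3 + 1 / 3 * of_nat d ^ 1)"
    unfolding sum_subtractf[symmetric]
  proof (intro sum.cong refl)
    fix d assume "d \<in> {d. d dvd n}"
    then have d: "d dvd n" "1 \<le> d" using n by (auto intro!: Suc_leI Nat.gr0I)
    have "f d d = - 14 * of_nat d ^ 6" by (simp add: f_def eval_nat_numeral)
    \<comment> \<open>Again the even terms, here those in \<open>d ^ 6\<close>, cancel.\<close>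
    then show "(of_nat (n div d) - 1) * f d d - (\<Sum>a = 1..<d. g a (d - a)) =
      7 * of_nat d ^ 5 - 14 * (of_nat n * of_nat d ^ 5) + 20 / 3 * of_nat d ^ 3 + 1 / 3 * of_nat d ^ 1"
      using of_nat_div_mult_power[of d n 5] d X[of d] by (simp add: left_diff_distrib)
  qed
  also have "\<dots> = 7 * divsigma 5 n - 14 * (of_nat n * divsigma 5 n) + 20 / 3 * divsigma 3 n
      + 1 / 3 * divsigma 1 n"
    unfolding divsigma_def sum_distrib_left sum_subtractf sum.distrib by (rule refl)
  finally show ?thesis by (simp add: field_simps)
qed

section \<open>Ramanujan's identities for formal power series in q\<close>

definition "E2_fps = 1 - 24 * divsigma_fps 1"
definition "E4_fps = 1 + 240 * divsigma_fps 3"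
definition "E6_fps = 1 - 504 * divsigma_fps 5"

lemmas Eisenstein_fps_defs = E2_fps_def E4_fps_def E6_fps_def

text \<open>\<open>fps_X * fps_deriv\<close> is \<open>q d/dq\<close>, which multiplies the
  coefficient of \<open>q^n\<close> by \<open>n\<close>, so the claim is a statement about the
  convolution of \<open>divsigma 1\<close> and \<open>divsigma 3\<close>.\<close>

lemma ramanujan_E4_fps:
  "3 * (fps_X * fps_deriv E4_fps) = E2_fps * E4_fps - E6_fps"
proof (rule fps_ext)
  have eq: "E2_fps * E4_fps - E6_fps = 240 * divsigma_fps 3 - 24 * divsigma_fps 1
      - 24 * (240 * (divsigma_fps 1 * divsigma_fps 3)) + 504 * divsigma_fps 5"
    by (simp add: Eisenstein_fps_defs algebra_simps)
  fix n
  show "fps_nth (3 * (fps_X * fps_deriv E4_fps)) n = fps_nth (E2_fps * E4_fps - E6_fps) n"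
  proof (cases "n = 0")
    case False
    have "fps_nth (E2_fps * E4_fps - E6_fps) n = 240 * divsigma 3 n - 24 * divsigma 1 n
        - 24 * (240 * fps_nth (divsigma_fps 1 * divsigma_fps 3) n) + 504 * divsigma 5 n"
      by (simp add: eq)
    \<comment> \<open>As \<open>24 * 21 = 504\<close> and \<open>24 * 10 = 240\<close>, all terms
      without the factor \<open>n\<close> cancel.\<close>
    also have "\<dots> = 720 * of_nat n * divsigma 3 n"
      using False by (subst divsigma_convolution_1_3) (auto simp: algebra_simps)
    finally show ?thesis using False by (cases n) (auto simp: E4_fps_def)
  qed (simp add: Eisenstein_fps_defs)
qed

lemma ramanujan_E6_fps:
  "2 * (fps_X * fps_deriv E6_fps) = E2_fps * E6_fps - E4_fps ^ 2"
proof (rule fps_ext)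
  have eq: "E2_fps * E6_fps - E4_fps ^ 2 = - (504 * divsigma_fps 5) - 24 * divsigma_fps 1
      - 480 * divsigma_fps 3 + 72 * (168 * (divsigma_fps 1 * divsigma_fps 5))
      - 57600 * (divsigma_fps 3 * divsigma_fps 3)"
    by (simp add: Eisenstein_fps_defs power2_eq_square algebra_simps)
  fix n
  show "fps_nth (2 * (fps_X * fps_deriv E6_fps)) n = fps_nth (E2_fps * E6_fps - E4_fps ^ 2) n"
  proof (cases "n = 0")
    case False
    have "fps_nth (E2_fps * E6_fps - E4_fps ^ 2) n = - 504 * divsigma 5 n - 24 * divsigma 1 n
        - 480 * divsigma 3 n + 72 * (168 * fps_nth (divsigma_fps 1 * divsigma_fps 5) n)
        - 57600 * fps_nth (divsigma_fps 3 * divsigma_fps 3) n"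
      by (simp add: eq)
    \<comment> \<open>Since \<open>72 * 800 = 57600\<close>, \<open>72 * 7 = 504\<close>,
      \<open>72 * 20 / 3 = 480\<close> and \<open>72 / 3 = 24\<close>, again only the term with the
      factor \<open>n\<close> remains.\<close>
    also have "\<dots> = - 1008 * of_nat n * divsigma 5 n"
      using False by (subst divsigma_convolution_1_5_3_3) (auto simp: algebra_simps)
    moreover have "\<dots> = fps_nth (2 * (fps_X * fps_deriv E6_fps)) n"
      using False by (cases n) (simp add: E6_fps_def, simp add: E6_fps_def ring_distribs)
    ultimately show ?thesis by simp
  qed (simp add: Eisenstein_fps_defs power2_eq_square)
qed

section \<open>Ramanujan's identities for the Eisenstein series\<close>

lemma norm_divsigma_le: "norm (divsigma k n) \<le> of_nat n ^ Suc k"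
proof (cases "n = 0")
  case False
  have "norm (divsigma k n) \<le> (\<Sum>d | d dvd n. real n ^ k)"
    unfolding divsigma_def using False
    by (intro sum_norm_le) (auto simp: norm_power intro!: power_mono dest: dvd_imp_le)
  also have "\<dots> \<le> real n * real n ^ k"
  proof -
    have "card {d. d dvd n} \<le> card {1..n}"
      using False by (intro card_mono) (auto intro!: Suc_leI Nat.gr0I dest: dvd_imp_le)
    then show ?thesis by (simp add: mult_right_mono)
  qed
  finally show ?thesis by simp
qed simp

text \<open>The coefficients grow polynomially: the series is dominated by the one with coefficients
  \<open>n ^ Suc k\<close>, whose radius is 1 by the ratio test.\<close>

lemma fps_conv_radius_divsigma_fps: "1 \<le> fps_conv_radius (divsigma_fps k)"
proof -
  have lim: "(\<lambda>n. (real n / real (Suc n)) ^ Suc k) \<longlonglongrightarrow> 1 ^ Suc k"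
    by (intro tendsto_power LIMSEQ_n_over_Suc_n)
  have rad: "conv_radius (\<lambda>n. real n ^ Suc k) = ereal 1"
    by (rule conv_radius_ratio_limit_nonzero[OF refl])
       (use lim in \<open>auto simp: power_divide norm_mult norm_power simp del: power_Suc of_nat_Suc\<close>)
  show ?thesis
    unfolding fps_conv_radius_def
  proof (rule conv_radius_geI_ex')
    fix r :: real assume r: "0 < r" "ereal r < 1"
    have "summable (\<lambda>n. real n ^ Suc k * r ^ n)"
      by (rule summable_in_conv_radius) (use rad r in auto)
    then show "summable (\<lambda>n. fps_nth (divsigma_fps k) n * of_real r ^ n)"
      by (rule summable_comparison_test')
         (use r norm_divsigma_le in \<open>auto simp: norm_mult norm_power simp del: power_Suc intro!: mult_right_mono\<close>)
  qed
qed

lemma norm_qvar_less_1: "z \<in> uhp \<Longrightarrow> norm (qvar z) < 1"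
  by (simp add: uhp_def qvar_def)

lemma open_uhp: "open uhp"
  by (simp add: uhp_def open_halfspace_Im_gt)

lemma less_fps_conv_radius_divsigma_fps:
  "norm w < 1 \<Longrightarrow> ereal (norm w) < fps_conv_radius (divsigma_fps k)"
  by (rule less_le_trans[OF _ fps_conv_radius_divsigma_fps]) simp

lemma less_fps_conv_radius_Eisenstein_fps:
  assumes "norm w < 1"
  shows "ereal (norm w) < fps_conv_radius E2_fps"
    and "ereal (norm w) < fps_conv_radius E4_fps"
    and "ereal (norm w) < fps_conv_radius E6_fps"
  unfolding Eisenstein_fps_defs
  using less_fps_conv_radius_divsigma_fps[OF assms]
  by (intro less_le_trans[OF _ fps_conv_radius_diff] less_le_trans[OF _ fps_conv_radius_add];
      simp add: less_le_trans[OF _ fps_conv_radius_mult])+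

lemma eval_divsigma_fps:
  assumes "norm w < 1"
  shows "eval_fps (divsigma_fps k) w = (\<Sum>n. divsigma k (Suc n) * w ^ Suc n)"
proof -
  have "summable (\<lambda>n. divsigma k n * w ^ n)"
    using summable_fps[OF less_fps_conv_radius_divsigma_fps[OF assms, of k]] by simp
  then show ?thesis
    by (subst suminf_split_head) (auto simp: eval_fps_def)
qed

lemma Eisenstein_eq_eval_fps:
  "E2 = onH (\<lambda>z. eval_fps E2_fps (qvar z))"
  "E4 = onH (\<lambda>z. eval_fps E4_fps (qvar z))"
  "E6 = onH (\<lambda>z. eval_fps E6_fps (qvar z))"
proof -
  have "eval_fps (c * divsigma_fps k) w = eval_fps c w * (\<Sum>n. divsigma k (Suc n) * w ^ Suc n)"
    and "ereal (norm w) < fps_conv_radius (c * divsigma_fps k)"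
    if "norm w < 1" "fps_conv_radius c = \<infinity>" for k c w
    using less_fps_conv_radius_divsigma_fps[OF that(1), of k] that
    by (auto simp: eval_fps_mult eval_divsigma_fps intro!: less_le_trans[OF _ fps_conv_radius_mult])
  then show "E2 = onH (\<lambda>z. eval_fps E2_fps (qvar z))"
    "E4 = onH (\<lambda>z. eval_fps E4_fps (qvar z))"
    "E6 = onH (\<lambda>z. eval_fps E6_fps (qvar z))"
    by (auto simp: E2_def E4_def E6_def onH_def fun_eq_iff Eisenstein_fps_defs norm_qvar_less_1
        eval_fps_add eval_fps_diff simp del: power_Suc)
qed

text \<open>Since \<open>q ^ n\<close> has derivative \<open>2 pi i n q ^ n\<close>, differentiation
  in \<open>z\<close> becomes \<open>q d/dq\<close> on series, up to the factor that
  \<open>qderiv\<close> divides out.\<close>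

lemma has_field_derivative_eval_fps_qvar:
  assumes "ereal (norm (qvar z)) < fps_conv_radius f"
  shows "((\<lambda>z. eval_fps f (qvar z)) has_field_derivative
    2 * of_real pi * \<i> * eval_fps (fps_X * fps_deriv f) (qvar z)) (at z)"
proof -
  have "(qvar has_field_derivative 2 * of_real pi * \<i> * qvar z) (at z)"
    unfolding qvar_def by (auto intro!: derivative_eq_intros)
  from DERIV_chain2[OF has_field_derivative_eval_fps[OF assms] this]
  show ?thesis
    using less_le_trans[OF assms fps_conv_radius_deriv]
    by (simp add: eval_fps_mult mult_ac)
qed

text \<open>\<open>onH f\<close> agrees with \<open>f\<close> on an open neighbourhood of
  \<open>z\<close>, so truncation does not affect the derivative.\<close>

lemma has_field_derivative_onH:
  assumes "(f has_field_derivative D) (at z)" "z \<in> uhp"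
  shows "(onH f has_field_derivative D) (at z)"
  using has_field_derivative_transform_within_open[OF assms(1) open_uhp assms(2)]
  by (simp add: onH_def)

lemma onH_in_Hol: "f holomorphic_on uhp \<Longrightarrow> onH f \<in> Hol"
  unfolding Hol_def using holomorphic_transform[of f uhp "onH f"] by (auto simp: onH_def)

lemma eval_fps_qvar_in_Hol:
  assumes "\<And>z. z \<in> uhp \<Longrightarrow> ereal (norm (qvar z)) < fps_conv_radius f"
  shows "onH (\<lambda>z. eval_fps f (qvar z)) \<in> Hol"
  using has_field_derivative_eval_fps_qvar[OF assms]
  by (intro onH_in_Hol) (auto simp: holomorphic_on_open[OF open_uhp])

lemma Eisenstein_in_Hol: "E2 \<in> Hol" "E4 \<in> Hol" "E6 \<in> Hol"
  unfolding Eisenstein_eq_eval_fps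
  by (intro eval_fps_qvar_in_Hol less_fps_conv_radius_Eisenstein_fps norm_qvar_less_1; assumption)+

lemma qderiv_eval_fps_qvar:
  assumes "z \<in> uhp" "ereal (norm (qvar z)) < fps_conv_radius f"
  shows "qderiv (onH (\<lambda>z. eval_fps f (qvar z))) z = eval_fps (fps_X * fps_deriv f) (qvar z)"
  using DERIV_imp_deriv[OF has_field_derivative_onH[OF
      has_field_derivative_eval_fps_qvar[OF assms(2)] assms(1)]] assms(1)
  by (simp add: qderiv_def onH_def)

text \<open>In these weights \<open>k / 12\<close> is 1/3 and 1/2, the factors of the
  \<open>E2\<close> terms in Ramanujan's identities; those terms cancel and a modular form
  remains.\<close>

lemma Dser_Eisenstein:
  "Dser 4 E4 = (\<lambda>z. - (1 / 3) * E6 z)"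
  "Dser 6 E6 = (\<lambda>z. - (1 / 2) * E4 z ^ 2)"
proof -
  have "Dser 4 E4 z = - (1 / 3) * E6 z \<and> Dser 6 E6 z = - (1 / 2) * E4 z ^ 2" for z
  proof (cases "z \<in> uhp")
    case True
    let ?w = "qvar z"
    have w: "norm ?w < 1" using norm_qvar_less_1[OF True] .
    note r = less_fps_conv_radius_Eisenstein_fps[OF w]
    have d: "ereal (norm ?w) < fps_conv_radius (fps_X * fps_deriv f)"
      if "ereal (norm ?w) < fps_conv_radius f" for f :: "complex fps"
      using less_le_trans[OF that fps_conv_radius_deriv]
      by (intro less_le_trans[OF _ fps_conv_radius_mult]) simp
    have m: "ereal (norm ?w) < fps_conv_radius (f * g)"
      if "ereal (norm ?w) < fps_conv_radius f" "ereal (norm ?w) < fps_conv_radius g"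
      for f g :: "complex fps"
      using that by (intro less_le_trans[OF _ fps_conv_radius_mult]) simp
    have "eval_fps (3 * (fps_X * fps_deriv E4_fps)) ?w = eval_fps (E2_fps * E4_fps - E6_fps) ?w"
      by (simp only: ramanujan_E4_fps)
    then have 1: "3 * qderiv E4 z = E2 z * E4 z - E6 z"
      using r d[OF r(2)] True
      by (simp add: eval_fps_mult[where f = 3] eval_fps_mult[where f = E2_fps] eval_fps_diff m
          Eisenstein_eq_eval_fps qderiv_eval_fps_qvar) (simp add: onH_def)
    have "eval_fps (2 * (fps_X * fps_deriv E6_fps)) ?w = eval_fps (E2_fps * E6_fps - E4_fps ^ 2) ?w"
      by (simp only: ramanujan_E6_fps)
    then have 2: "2 * qderiv E6 z = E2 z * E6 z - E4 z ^ 2"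
      using r d[OF r(3)] True less_le_trans[OF r(2) fps_conv_radius_power]
      by (simp add: eval_fps_mult[where f = 2] eval_fps_mult[where f = E2_fps] eval_fps_diff m
          eval_fps_power Eisenstein_eq_eval_fps qderiv_eval_fps_qvar) (simp add: onH_def)
    show ?thesis using 1 2 by (simp add: Dser_def field_simps)
  qed (auto simp: Dser_def qderiv_def E4_def E6_def onH_def)
  then show "Dser 4 E4 = (\<lambda>z. - (1 / 3) * E6 z)" "Dser 6 E6 = (\<lambda>z. - (1 / 2) * E4 z ^ 2)"
    by auto
qed

section \<open>The graded algebra and its derivation\<close>

lemma HolI: "f holomorphic_on uhp \<Longrightarrow> (\<And>z. z \<notin> uhp \<Longrightarrow> f z = 0) \<Longrightarrow> f \<in> Hol"
  by (simp add: Hol_def)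

lemma Hol_holomorphic: "f \<in> Hol \<Longrightarrow> f holomorphic_on uhp"
  by (simp add: Hol_def)

lemma Hol_outside: "f \<in> Hol \<Longrightarrow> z \<notin> uhp \<Longrightarrow> f z = 0"
  by (simp add: Hol_def)

lemma Hol_has_field_derivative:
  "f \<in> Hol \<Longrightarrow> z \<in> uhp \<Longrightarrow> (f has_field_derivative deriv f z) (at z)"
  using holomorphic_derivI[OF Hol_holomorphic open_uhp] by blast

lemma Hol_zero [simp]: "(\<lambda>_. 0) \<in> Hol"
  by (simp add: Hol_def)

lemma Hol_add: "f \<in> Hol \<Longrightarrow> g \<in> Hol \<Longrightarrow> (\<lambda>z. f z + g z) \<in> Hol"
  by (auto intro!: HolI holomorphic_intros simp: Hol_holomorphic Hol_outside)

lemma Hol_mult: "f \<in> Hol \<Longrightarrow> g \<in> Hol \<Longrightarrow> (\<lambda>z. f z * g z) \<in> Hol"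
  by (auto intro!: HolI holomorphic_intros simp: Hol_holomorphic Hol_outside)

lemma Hol_cmult: "f \<in> Hol \<Longrightarrow> (\<lambda>z. c * f z) \<in> Hol"
  by (auto intro!: HolI holomorphic_intros simp: Hol_holomorphic Hol_outside)

lemma Hol_sum: "(\<And>i. i \<in> I \<Longrightarrow> f i \<in> Hol) \<Longrightarrow> (\<lambda>z. \<Sum>i\<in>I. f i z) \<in> Hol"
  by (auto intro!: HolI holomorphic_intros simp: Hol_holomorphic Hol_outside)

lemma qderiv_in_Hol: "f \<in> Hol \<Longrightarrow> qderiv f \<in> Hol"
  unfolding qderiv_def
  by (auto intro!: onH_in_Hol holomorphic_intros holomorphic_deriv open_uhp simp: Hol_holomorphic)

lemma Dser_in_Hol: "f \<in> Hol \<Longrightarrow> Dser k f \<in> Hol"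
  using Hol_add[OF qderiv_in_Hol Hol_cmult[OF Hol_mult[OF Eisenstein_in_Hol(1)], of f "- (of_real k / 12)"]]
  by (simp add: Dser_def mult.assoc)

lemma Dser_zero [simp]: "Dser k (\<lambda>_. 0) = (\<lambda>_. 0)"
  by (auto simp: Dser_def qderiv_def onH_def)

lemma Dser_sum:
  assumes "\<And>i. i \<in> I \<Longrightarrow> f i \<in> Hol"
  shows "Dser k (\<lambda>z. \<Sum>i\<in>I. f i z) = (\<lambda>z. \<Sum>i\<in>I. Dser k (f i) z)"
proof
  fix z
  show "Dser k (\<lambda>z. \<Sum>i\<in>I. f i z) z = (\<Sum>i\<in>I. Dser k (f i) z)"
  proof (cases "z \<in> uhp")
    case True
    then have "((\<lambda>z. \<Sum>i\<in>I. f i z) has_field_derivative (\<Sum>i\<in>I. deriv (f i) z)) (at z)"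
      using assms by (intro DERIV_sum Hol_has_field_derivative)
    then show ?thesis
      using True by (simp add: Dser_def qderiv_def onH_def DERIV_imp_deriv sum_subtractf
          sum_distrib_left sum_divide_distrib)
  qed (use assms Dser_in_Hol in \<open>auto simp: Dser_def qderiv_def onH_def Hol_outside\<close>)
qed

text \<open>The correction term is linear in the weight, so splitting the weight as
  \<open>k + l\<close> hands each factor its own share.\<close>

lemma Dser_mult:
  assumes "f \<in> Hol" "g \<in> Hol"
  shows "Dser (k + l) (\<lambda>z. f z * g z) = (\<lambda>z. Dser k f z * g z + f z * Dser l g z)"
proof
  fix z
  show "Dser (k + l) (\<lambda>z. f z * g z) z = Dser k f z * g z + f z * Dser l g z"
  proof (cases "z \<in> uhp")
    case True
    then have "((\<lambda>z. f z * g z) has_field_derivative deriv f z * g z + deriv g z * f z) (at z)"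
      using assms by (intro DERIV_mult Hol_has_field_derivative)
    then show ?thesis
      using True by (simp add: Dser_def qderiv_def onH_def DERIV_imp_deriv add_divide_distrib algebra_simps)
  qed (use assms in \<open>auto simp: Dser_def qderiv_def onH_def Hol_outside\<close>)
qed

lemma Dser_cmult:
  assumes "f \<in> Hol"
  shows "Dser k (\<lambda>z. c * f z) = (\<lambda>z. c * Dser k f z)"
proof
  fix z
  show "Dser k (\<lambda>z. c * f z) z = c * Dser k f z"
  proof (cases "z \<in> uhp")
    case True
    have "((\<lambda>z. c * f z) has_field_derivative c * deriv f z) (at z)"
      using assms True by (intro DERIV_cmult Hol_has_field_derivative)
    then show ?thesis
      using True by (simp add: Dser_def qderiv_def onH_def DERIV_imp_deriv algebra_simps)
  qed (use assms in \<open>auto simp: Dser_def qderiv_def onH_def Hol_outside\<close>)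
qed

section \<open>Finitely supported graded elements and their product\<close>

lemma Hcar_finite_supp: "h \<in> Hcar \<Longrightarrow> finite (supp h)"
  by (simp add: Hcar_def)

lemma Hcar_Hol: "h \<in> Hcar \<Longrightarrow> h n \<in> Hol"
  by (simp add: Hcar_def)

lemma HcarI: "finite A \<Longrightarrow> (\<And>n. n \<notin> A \<Longrightarrow> h n = (\<lambda>_. 0)) \<Longrightarrow> (\<And>n. h n \<in> Hol) \<Longrightarrow> h \<in> Hcar"
  unfolding Hcar_def by (auto simp: supp_def intro: finite_subset[of _ A])

lemma not_in_supp: "n \<notin> supp h \<Longrightarrow> h n = (\<lambda>_. 0)"
  by (simp add: supp_def)

lemma Hcar_zero [simp]: "(\<lambda>_ _. 0) \<in> Hcar"
  by (rule HcarI[of "{}"]) auto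

lemma Hcar_add:
  assumes "r \<in> Hcar" "s \<in> Hcar"
  shows "(\<lambda>n z. r n z + s n z) \<in> Hcar"
  by (rule HcarI[of "supp r \<union> supp s"]) (use assms in \<open>auto simp: Hcar_finite_supp not_in_supp Hcar_Hol Hol_add\<close>)

lemma Hcar_cmult: "r \<in> Hcar \<Longrightarrow> (\<lambda>n z. c * r n z) \<in> Hcar"
  by (rule HcarI[of "supp r"]) (auto simp: Hcar_finite_supp not_in_supp Hcar_Hol Hol_cmult)

lemma Hcar_sum:
  assumes "\<And>i. i \<in> I \<Longrightarrow> r i \<in> Hcar"
  shows "(\<lambda>n z. \<Sum>i\<in>I. r i n z) \<in> Hcar"
  using assms
  by (induction I rule: infinite_finite_induct) (auto intro: Hcar_add)

lemma hom_in_Hcar: "f \<in> Hol \<Longrightarrow> hom n f \<in> Hcar"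
  by (rule HcarI[of "{n}"]) (auto simp: hom_def)

lemma supp_hom: "supp (hom n f) \<subseteq> {n}"
  by (auto simp: supp_def hom_def)

text \<open>Cancellation can shrink supports, so calculations run over a common finite
  superset.\<close>

lemma grmult_eq_sum:
  assumes "finite A" "supp r \<subseteq> A"
  shows "grmult r h n z = (\<Sum>a\<in>A. r a z * h (n - a) z)"
  unfolding grmult_def by (rule sum.mono_neutral_left) (use assms in \<open>auto simp: supp_def\<close>)

lemma grmult_hom: "grmult (hom k f) h n z = f z * h (n - k) z"
  by (subst grmult_eq_sum[of "{k}"]) (auto simp: supp_hom, auto simp: hom_def)

lemma grmult_in_Hcar:
  assumes "r \<in> Hcar" "h \<in> Hcar"
  shows "grmult r h \<in> Hcar"
proof (rule HcarI[of "\<Union>a\<in>supp r. (+) a ` supp h"])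
  show "grmult r h n = (\<lambda>_. 0)" if "n \<notin> (\<Union>a\<in>supp r. (+) a ` supp h)" for n
  proof -
    have "n - a \<notin> supp h" if "a \<in> supp r" for a
      using that \<open>n \<notin> _\<close> by (metis UN_I add.commute diff_add_cancel image_eqI)
    then show ?thesis by (auto simp: grmult_def not_in_supp intro!: sum.neutral)
  qed
qed (use assms in \<open>auto simp: grmult_def Hcar_finite_supp Hcar_Hol intro!: Hol_sum Hol_mult\<close>)

lemma grmult_zero_left [simp]: "grmult (\<lambda>_ _. 0) h = (\<lambda>_ _. 0)"
  by (simp add: grmult_def fun_eq_iff supp_def)

lemma grmult_zero_right [simp]: "grmult r (\<lambda>_ _. 0) = (\<lambda>_ _. 0)"
  by (simp add: grmult_def fun_eq_iff)

text \<open>Stated for linear combinations: a sum over \<open>bool\<close> gives additivity and a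
  sum over one point gives homogeneity.\<close>

lemma grmult_sum_left:
  assumes "finite I" "\<And>i. i \<in> I \<Longrightarrow> finite (supp (r i))"
  shows "grmult (\<lambda>n z. \<Sum>i\<in>I. c i * r i n z) h n z = (\<Sum>i\<in>I. c i * grmult (r i) h n z)"
proof -
  let ?A = "\<Union>i\<in>I. supp (r i)"
  have fin: "finite ?A" using assms by auto
  have "supp (\<lambda>n z. \<Sum>i\<in>I. c i * r i n z) \<subseteq> ?A"
    by (force simp: supp_def fun_eq_iff intro!: sum.neutral)
  then have "grmult (\<lambda>n z. \<Sum>i\<in>I. c i * r i n z) h n z =
      (\<Sum>a\<in>?A. (\<Sum>i\<in>I. c i * r i a z) * h (n - a) z)"
    by (rule grmult_eq_sum[OF fin])
  also have "\<dots> = (\<Sum>i\<in>I. c i * (\<Sum>a\<in>?A. r i a z * h (n - a) z))"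
    by (simp add: sum_distrib_left sum_distrib_right mult.assoc) (rule sum.swap)
  also have "\<dots> = (\<Sum>i\<in>I. c i * grmult (r i) h n z)"
    by (intro sum.cong refl arg_cong2[of _ _ _ _ "(*)"] grmult_eq_sum[symmetric] fin) auto
  finally show ?thesis .
qed

lemma grmult_add_left:
  assumes "r \<in> Hcar" "s \<in> Hcar"
  shows "grmult (\<lambda>n z. r n z + s n z) h n z = grmult r h n z + grmult s h n z"
  using grmult_sum_left[of UNIV "\<lambda>b. if b then r else s" "\<lambda>_. 1"] assms
  by (simp add: UNIV_bool add.commute Hcar_finite_supp)

lemma grmult_cmult_left:
  assumes "r \<in> Hcar"
  shows "grmult (\<lambda>n z. c * r n z) h n z = c * grmult r h n z"
  using grmult_sum_left[of "{()}" "\<lambda>_. r" "\<lambda>_. c"] assms by (simp add: Hcar_finite_supp)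

lemma grmult_sum_right:
  "grmult r (\<lambda>n z. \<Sum>i\<in>I. c i * h i n z) n z = (\<Sum>i\<in>I. c i * grmult r (h i) n z)"
  unfolding grmult_def
  by (simp add: sum_distrib_left mult.left_commute) (rule sum.swap)

lemma grmult_assoc:
  assumes "r \<in> Hcar" "s \<in> Hcar"
  shows "grmult (grmult r s) h = grmult r (grmult s h)"
proof (intro ext)
  fix n z
  \<comment> \<open>\<open>?C\<close> contains all degrees \<open>a + b\<close> of products, so it
    can serve as the range of summation on both sides, whatever cancels in
    \<open>grmult r s\<close>.\<close>
  let ?C = "supp (grmult r s) \<union> (\<Union>a\<in>supp r. (+) a ` supp s)"
  have fin: "finite ?C"
    using assms grmult_in_Hcar[OF assms] by (auto simp: Hcar_finite_supp)
  have "grmult (grmult r s) h n z = (\<Sum>c\<in>?C. \<Sum>a\<in>supp r. r a z * (s (c - a) z * h (n - c) z))"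
    by (subst grmult_eq_sum[OF fin]) (auto simp: grmult_def sum_distrib_right mult.assoc)
  also have "\<dots> = (\<Sum>a\<in>supp r. r a z * (\<Sum>c\<in>?C. s (c - a) z * h (n - c) z))"
    by (subst sum.swap) (simp add: sum_distrib_left)
  also have "\<dots> = (\<Sum>a\<in>supp r. r a z * grmult s h (n - a) z)"
  proof (intro sum.cong refl arg_cong2[of _ _ _ _ "(*)"])
    fix a assume a: "a \<in> supp r"
    have "(\<Sum>c\<in>?C. s (c - a) z * h (n - c) z) = (\<Sum>c\<in>(+) a ` supp s. s (c - a) z * h (n - c) z)"
    proof (rule sum.mono_neutral_right[OF fin])
      show "\<forall>c\<in>?C - (+) a ` supp s. s (c - a) z * h (n - c) z = 0"
      proof
        fix c assume "c \<in> ?C - (+) a ` supp s"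
        then have "c - a \<notin> supp s" by (metis DiffD2 add.commute diff_add_cancel image_eqI)
        then show "s (c - a) z * h (n - c) z = 0" by (simp add: not_in_supp)
      qed
    qed (use a in auto)
    also have "\<dots> = grmult s h (n - a) z"
      by (subst sum.reindex) (auto simp: grmult_def diff_diff_eq)
    finally show "(\<Sum>c\<in>?C. s (c - a) z * h (n - c) z) = grmult s h (n - a) z" .
  qed
  finally show "grmult (grmult r s) h n z = grmult r (grmult s h) n z"
    by (simp add: grmult_def)
qed

section \<open>The operator \<open>deltaH\<close> as a derivation of \<open>H\<close>\<close>

lemma deltaH_in_Hcar:
  assumes "h \<in> Hcar" shows "deltaH h \<in> Hcar"
proof (rule HcarI[of "(\<lambda>n. n + 2) ` supp h"])
  show "deltaH h n = (\<lambda>_. 0)" if "n \<notin> (\<lambda>n. n + 2) ` supp h" for n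
  proof -
    have "n - 2 \<notin> supp h" using that by (metis diff_add_cancel image_eqI)
    then show ?thesis by (simp add: deltaH_def not_in_supp)
  qed
qed (use assms in \<open>auto simp: deltaH_def Hcar_finite_supp Hcar_Hol Dser_in_Hol\<close>)

lemma deltaH_pow_in_Hcar: "h \<in> Hcar \<Longrightarrow> (deltaH ^^ k) h \<in> Hcar"
  by (induction k) (auto simp: deltaH_in_Hcar)

lemma deltaH_pow_sum:
  assumes "\<And>i. i \<in> I \<Longrightarrow> r i \<in> Hcar"
  shows "(deltaH ^^ k) (\<lambda>n z. \<Sum>i\<in>I. r i n z) = (\<lambda>n z. \<Sum>i\<in>I. (deltaH ^^ k) (r i) n z)"
  using assms
  by (induction k) (simp_all add: deltaH_def Dser_sum Hcar_Hol deltaH_pow_in_Hcar)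

lemma deltaH_pow_add:
  assumes "r \<in> Hcar" "s \<in> Hcar"
  shows "(deltaH ^^ k) (\<lambda>n z. r n z + s n z) = (\<lambda>n z. (deltaH ^^ k) r n z + (deltaH ^^ k) s n z)"
  using deltaH_pow_sum[of UNIV "\<lambda>b. if b then r else s"] assms by (simp add: UNIV_bool add.commute)

text \<open>Each term in degree \<open>n - 2\<close> is a product of weights \<open>a\<close> and
  \<open>n - 2 - a\<close>, to which \<open>Dser_mult\<close> applies.\<close>

lemma deltaH_grmult:
  assumes "r \<in> Hcar" "h \<in> Hcar"
  shows "deltaH (grmult r h) = (\<lambda>n z. grmult (deltaH r) h n z + grmult r (deltaH h) n z)"
proof (intro ext)
  fix n z
  have "deltaH (grmult r h) n z = (\<Sum>a\<in>supp r. Dser (n - 2) (\<lambda>z. r a z * h (n - 2 - a) z) z)"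
    using assms by (simp add: deltaH_def grmult_def[abs_def] Dser_sum Hol_mult Hcar_Hol)
  also have "\<dots> = (\<Sum>a\<in>supp r. Dser a (r a) z * h (n - 2 - a) z + r a z * Dser (n - 2 - a) (h (n - 2 - a)) z)"
  proof (intro sum.cong refl)
    fix a
    show "Dser (n - 2) (\<lambda>z. r a z * h (n - 2 - a) z) z =
        Dser a (r a) z * h (n - 2 - a) z + r a z * Dser (n - 2 - a) (h (n - 2 - a)) z"
      using fun_cong[OF Dser_mult[OF Hcar_Hol[OF assms(1)] Hcar_Hol[OF assms(2)], of a "n - 2 - a" a "n - 2 - a"], of z]
      by simp
  qed
  also have "\<dots> = (\<Sum>a\<in>supp r. Dser a (r a) z * h (n - 2 - a) z) + grmult r (deltaH h) n z"
    by (simp add: sum.distrib grmult_def deltaH_def algebra_simps)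
  also have "(\<Sum>a\<in>supp r. Dser a (r a) z * h (n - 2 - a) z) = grmult (deltaH r) h n z"
  proof -
    have "supp (deltaH r) \<subseteq> (\<lambda>n. n + 2) ` supp r"
    proof
      fix a assume "a \<in> supp (deltaH r)"
      then have "a - 2 \<in> supp r" by (auto simp: supp_def deltaH_def)
      then show "a \<in> (\<lambda>n. n + 2) ` supp r" by (metis diff_add_cancel image_eqI)
    qed
    then have "grmult (deltaH r) h n z = (\<Sum>a\<in>(\<lambda>n. n + 2) ` supp r. deltaH r a z * h (n - a) z)"
      using assms by (intro grmult_eq_sum) (auto simp: Hcar_finite_supp)
    also have "\<dots> = (\<Sum>a\<in>supp r. Dser a (r a) z * h (n - 2 - a) z)"
      by (subst sum.reindex) (auto simp: deltaH_def algebra_simps inj_on_def)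
    finally show ?thesis ..
  qed
  finally show "deltaH (grmult r h) n z = grmult (deltaH r) h n z + grmult r (deltaH h) n z" .
qed

text \<open>The induction strips one \<open>deltaH\<close> from the inside, so \<open>r\<close> and
  \<open>h\<close> must vary; Pascal's rule recombines the two sums.\<close>

lemma deltaH_pow_grmult:
  assumes "r \<in> Hcar" "h \<in> Hcar"
  shows "(deltaH ^^ k) (grmult r h) n z =
    (\<Sum>i\<le>k. of_nat (k choose i) * grmult ((deltaH ^^ i) r) ((deltaH ^^ (k - i)) h) n z)"
  using assms
proof (induction k arbitrary: r h)
  case (Suc k)
  let ?T = "\<lambda>i j. grmult ((deltaH ^^ i) r) ((deltaH ^^ j) h) n z"
  have "(deltaH ^^ Suc k) (grmult r h) n z =
      (deltaH ^^ k) (grmult (deltaH r) h) n z + (deltaH ^^ k) (grmult r (deltaH h)) n z"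
    using Suc.prems
    by (simp add: funpow_swap1 deltaH_grmult deltaH_pow_add grmult_in_Hcar deltaH_in_Hcar)
  also have "\<dots> = (\<Sum>i\<le>k. of_nat (k choose i) * ?T (Suc i) (k - i)) +
      (\<Sum>i\<le>k. of_nat (k choose i) * ?T i (Suc k - i))"
    using Suc.prems
    by (simp add: Suc.IH deltaH_in_Hcar funpow_swap1 Suc_diff_le)
  \<comment> \<open>The added term \<open>i = Suc k\<close> is 0 because
    \<open>k choose Suc k\<close> is.\<close>
  also have "(\<Sum>i\<le>k. of_nat (k choose i) * ?T i (Suc k - i)) =
      (\<Sum>i\<le>Suc k. of_nat (k choose i) * ?T i (Suc k - i))"
    by simp
  also have "\<dots> = ?T 0 (Suc k) + (\<Sum>i\<le>k. of_nat (k choose Suc i) * ?T (Suc i) (k - i))"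
    by (subst sum.atMost_Suc_shift) simp
  also have "(\<Sum>i\<le>k. of_nat (k choose i) * ?T (Suc i) (k - i)) + \<dots> =
      (\<Sum>i\<le>Suc k. of_nat (Suc k choose i) * ?T i (Suc k - i))"
    by (simp only: sum.atMost_Suc_shift) (simp add: sum.distrib algebra_simps)
  finally show ?case .
qed simp

section \<open>Modular forms\<close>

text \<open>\<open>onH\<close> makes the empty monomial vanish off the upper half plane, where the
  bare product would be \<open>0 ^ 0 * 0 ^ 0 = 1\<close>.\<close>

definition Emono :: "nat \<Rightarrow> nat \<Rightarrow> complex \<Rightarrow> complex" where
  "Emono i j = onH (\<lambda>z. E4 z ^ i * E6 z ^ j)"

lemma Emono_in_Hol: "Emono i j \<in> Hol"
  unfolding Emono_def
  by (intro onH_in_Hol holomorphic_intros Hol_holomorphic Eisenstein_in_Hol)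

lemma Emono_Suc_left: "Emono (Suc i) j = (\<lambda>z. E4 z * Emono i j z)"
  by (simp add: Emono_def onH_def fun_eq_iff)

lemma Emono_Suc_right: "Emono i (Suc j) = (\<lambda>z. E6 z * Emono i j z)"
  by (simp add: Emono_def onH_def fun_eq_iff)

lemma Emono_1_0: "Emono 1 0 = E4" and Emono_0_1: "Emono 0 1 = E6"
  by (simp_all add: Emono_def onH_def fun_eq_iff E4_def E6_def)

lemma Emono_mult: "Emono i j z * Emono i' j' z = Emono (i + i') (j + j') z"
  by (simp add: Emono_def onH_def power_add)

lemma finite_wts: "finite (wts k)"
proof (rule finite_subset)
  show "wts k \<subseteq> {..nat \<lfloor>k\<rfloor>} \<times> {..nat \<lfloor>k\<rfloor>}"
  proof (rule subrelI)
    fix i j assume "(i, j) \<in> wts k"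
    then have "real i \<le> k" "real j \<le> k" by (auto simp: wts_def)
    then show "(i, j) \<in> {..nat \<lfloor>k\<rfloor>} \<times> {..nat \<lfloor>k\<rfloor>}" by (simp add: le_nat_floor)
  qed
qed simp

lemma Mk_iff: "f \<in> Mk k \<longleftrightarrow> (\<exists>c. f = (\<lambda>z. \<Sum>(i, j)\<in>wts k. c (i, j) * Emono i j z))"
proof -
  have "onH (\<lambda>z. \<Sum>p\<in>wts k. c p * E4 z ^ fst p * E6 z ^ snd p) =
      (\<lambda>z. \<Sum>(i, j)\<in>wts k. c (i, j) * Emono i j z)" for c
    by (simp add: onH_def Emono_def fun_eq_iff case_prod_unfold mult.assoc)
  then show ?thesis by (simp add: Mk_def)
qed

lemma Mk_zero [simp]: "(\<lambda>_. 0) \<in> Mk k"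
  unfolding Mk_iff by (rule exI[of _ "\<lambda>_. 0"]) simp

lemma Mk_add:
  assumes "f \<in> Mk k" "g \<in> Mk k" shows "(\<lambda>z. f z + g z) \<in> Mk k"
proof -
  from assms obtain c d where "f = (\<lambda>z. \<Sum>(i, j)\<in>wts k. c (i, j) * Emono i j z)"
    "g = (\<lambda>z. \<Sum>(i, j)\<in>wts k. d (i, j) * Emono i j z)"
    unfolding Mk_iff by blast
  then show ?thesis
    unfolding Mk_iff
    by (intro exI[of _ "\<lambda>p. c p + d p"]) (simp add: case_prod_unfold sum.distrib distrib_right)
qed

lemma Mk_cmult:
  assumes "f \<in> Mk k" shows "(\<lambda>z. a * f z) \<in> Mk k"
proof -
  from assms obtain c where "f = (\<lambda>z. \<Sum>(i, j)\<in>wts k. c (i, j) * Emono i j z)"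
    unfolding Mk_iff by blast
  then show ?thesis
    unfolding Mk_iff
    by (intro exI[of _ "\<lambda>p. a * c p"]) (simp add: case_prod_unfold sum_distrib_left mult.assoc)
qed

lemma Mk_sum: "(\<And>i. i \<in> I \<Longrightarrow> f i \<in> Mk k) \<Longrightarrow> (\<lambda>z. \<Sum>i\<in>I. f i z) \<in> Mk k"
  by (induction I rule: infinite_finite_induct) (auto intro: Mk_add)

lemma Emono_in_Mk:
  assumes "k = real (4 * i + 6 * j)" shows "Emono i j \<in> Mk k"
  unfolding Mk_iff
proof (rule exI[of _ "\<lambda>p. if p = (i, j) then 1 else 0"], rule ext)
  fix z
  have "Emono i j z = (\<Sum>p\<in>wts k. if p = (i, j) then Emono i j z else 0)"
    using assms by (subst sum.delta[OF finite_wts]) (simp add: wts_def)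
  also have "\<dots> = (\<Sum>(i', j')\<in>wts k. (if (i', j') = (i, j) then 1 else 0) * Emono i' j' z)"
    by (intro sum.cong refl) (auto split: if_splits)
  finally show "Emono i j z = \<dots>" .
qed

lemma Mk_mult:
  assumes "f \<in> Mk k" "g \<in> Mk l" shows "(\<lambda>z. f z * g z) \<in> Mk (k + l)"
proof -
  from assms obtain c d where cd: "f = (\<lambda>z. \<Sum>(i, j)\<in>wts k. c (i, j) * Emono i j z)"
    "g = (\<lambda>z. \<Sum>(i, j)\<in>wts l. d (i, j) * Emono i j z)"
    unfolding Mk_iff by blast
  have "(\<lambda>z. f z * g z) = (\<lambda>z. \<Sum>p\<in>wts k. \<Sum>q\<in>wts l.
      (c p * d q) * Emono (fst p + fst q) (snd p + snd q) z)"
    unfolding cd by (simp add: sum_product case_prod_unfold Emono_mult[symmetric] mult_ac)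
  then show ?thesis
    by (auto intro!: Mk_sum Mk_cmult Emono_in_Mk simp: wts_def)
qed

lemma Mk_subset_Hol: "Mk k \<subseteq> Hol"
  unfolding Mk_iff[abs_def] subset_iff
  by (auto simp: case_prod_unfold intro!: Hol_sum Hol_cmult Emono_in_Hol)

text \<open>The Leibniz rule splits off one factor at a time; Ramanujan's identities put the
  derivatives of \<open>E4\<close> and \<open>E6\<close> in weights 6 and 8.\<close>

lemma Dser_Emono_in_Mk: "Dser (real (4 * i + 6 * j)) (Emono i j) \<in> Mk (real (4 * i + 6 * j) + 2)"
proof (induction i)
  case 0
  show ?case
  proof (induction j)
    case 0
    \<comment> \<open>The monomial is the constant 1 of weight 0, so both the derivative and the
      \<open>E2\<close> term vanish.\<close>
    have "qderiv (Emono 0 0) = (\<lambda>_. 0)"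
      using DERIV_imp_deriv[OF has_field_derivative_onH[OF DERIV_const]]
      by (auto simp: qderiv_def Emono_def onH_def)
    then show ?case by (simp add: Dser_def)
  next
    case (Suc j)
    let ?k = "real (4 * 0 + 6 * j)"
    have "Emono 0 (Suc j) = (\<lambda>z. E6 z * Emono 0 j z)" by (rule Emono_Suc_right)
    moreover have "Dser (6 + ?k) (\<lambda>z. E6 z * Emono 0 j z) \<in> Mk (6 + ?k + 2)"
    proof -
      have "(\<lambda>z. - (1 / 2) * (E4 z * E4 z)) \<in> Mk (4 + 4)"
        using Emono_in_Mk[of 4 1 0] by (intro Mk_cmult Mk_mult) (auto simp: Emono_1_0[unfolded One_nat_def])
      then have "(\<lambda>z. Dser 6 E6 z * Emono 0 j z) \<in> Mk (4 + 4 + ?k)"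
        by (intro Mk_mult Emono_in_Mk) (auto simp: Dser_Eisenstein power2_eq_square)
      moreover have "(\<lambda>z. E6 z * Dser ?k (Emono 0 j) z) \<in> Mk (6 + (?k + 2))"
        using Emono_in_Mk[of 6 0 1] by (intro Mk_mult Suc.IH) (auto simp: Emono_0_1[unfolded One_nat_def])
      ultimately show ?thesis
        by (subst Dser_mult[OF Eisenstein_in_Hol(3) Emono_in_Hol]) (auto intro!: Mk_add simp: add_ac)
    qed
    ultimately show ?case by (simp add: algebra_simps)
  qed
next
  case (Suc i)
  let ?k = "real (4 * i + 6 * j)"
  have "Emono (Suc i) j = (\<lambda>z. E4 z * Emono i j z)" by (rule Emono_Suc_left)
  moreover have "Dser (4 + ?k) (\<lambda>z. E4 z * Emono i j z) \<in> Mk (4 + ?k + 2)"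
  proof -
    have "(\<lambda>z. - (1 / 3) * E6 z) \<in> Mk 6"
      using Emono_in_Mk[of 6 0 1] by (intro Mk_cmult) (auto simp: Emono_0_1[unfolded One_nat_def])
    then have "(\<lambda>z. Dser 4 E4 z * Emono i j z) \<in> Mk (6 + ?k)"
      by (intro Mk_mult Emono_in_Mk) (auto simp: Dser_Eisenstein)
    moreover have "(\<lambda>z. E4 z * Dser ?k (Emono i j) z) \<in> Mk (4 + (?k + 2))"
      using Emono_in_Mk[of 4 1 0] by (intro Mk_mult Suc.IH) (auto simp: Emono_1_0[unfolded One_nat_def])
    ultimately show ?thesis
      by (subst Dser_mult[OF Eisenstein_in_Hol(2) Emono_in_Hol]) (auto intro!: Mk_add simp: add_ac)
  qed
  ultimately show ?case by (simp add: algebra_simps)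
qed

lemma Dser_in_Mk:
  assumes "f \<in> Mk k" shows "Dser k f \<in> Mk (k + 2)"
proof -
  from assms obtain c where c: "f = (\<lambda>z. \<Sum>p\<in>wts k. c p * Emono (fst p) (snd p) z)"
    unfolding Mk_iff case_prod_unfold by auto
  have "Dser k f = (\<lambda>z. \<Sum>p\<in>wts k. c p * Dser k (Emono (fst p) (snd p)) z)"
    unfolding c by (simp add: Dser_sum Dser_cmult Hol_cmult Emono_in_Hol)
  moreover have "Dser k (Emono (fst p) (snd p)) \<in> Mk (k + 2)" if "p \<in> wts k" for p
    using Dser_Emono_in_Mk[of "fst p" "snd p"] that by (auto simp: wts_def)
  ultimately show ?thesis by (simp only:) (intro Mk_sum Mk_cmult)
qed

section \<open>The graded ring \<open>Mcar\<close> and its closure properties\<close>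

lemma Mcar_Hcar: "r \<in> Mcar \<Longrightarrow> r \<in> Hcar"
  by (simp add: Mcar_def)

lemma Mcar_zero [simp]: "(\<lambda>_ _. 0) \<in> Mcar"
  by (simp add: Mcar_def)

lemma Mcar_add: "r \<in> Mcar \<Longrightarrow> s \<in> Mcar \<Longrightarrow> (\<lambda>n z. r n z + s n z) \<in> Mcar"
  by (simp add: Mcar_def Hcar_add Mk_add)

lemma Mcar_cmult: "r \<in> Mcar \<Longrightarrow> (\<lambda>n z. c * r n z) \<in> Mcar"
  by (simp add: Mcar_def Hcar_cmult Mk_cmult)

lemma Mcar_sum: "(\<And>i. i \<in> I \<Longrightarrow> r i \<in> Mcar) \<Longrightarrow> (\<lambda>n z. \<Sum>i\<in>I. r i n z) \<in> Mcar"
  by (simp add: Mcar_def Hcar_sum Mk_sum)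

lemma Mcar_hom: "f \<in> Mk n \<Longrightarrow> hom n f \<in> Mcar"
  using Mk_subset_Hol[of n] by (auto simp: Mcar_def hom_in_Hcar subset_iff) (simp add: hom_def)

lemma Mcar_grmult:
  assumes "r \<in> Mcar" "s \<in> Mcar" shows "grmult r s \<in> Mcar"
proof -
  have "(\<lambda>z. r a z * s (n - a) z) \<in> Mk n" for a n
    using Mk_mult[of "r a" a "s (n - a)" "n - a"] assms by (simp add: Mcar_def)
  then show ?thesis
    using assms by (simp add: Mcar_def grmult_in_Hcar) (simp add: grmult_def Mk_sum)
qed

lemma Mcar_deltaH: "r \<in> Mcar \<Longrightarrow> deltaH r \<in> Mcar"
  using Dser_in_Mk[of "r (n - 2)" "n - 2" for n]
  by (simp add: Mcar_def deltaH_in_Hcar) (simp add: deltaH_def)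

lemma Mcar_deltaH_pow: "r \<in> Mcar \<Longrightarrow> (deltaH ^^ k) r \<in> Mcar"
  by (induction k) (auto simp: Mcar_deltaH)

section \<open>The action of the skew polynomial ring\<close>

lemma SkewI:
  "finite K \<Longrightarrow> (\<And>k. k \<notin> K \<Longrightarrow> p k = (\<lambda>_ _. 0)) \<Longrightarrow> (\<And>k. p k \<in> Mcar) \<Longrightarrow> p \<in> Skew"
  unfolding Skew_def by (auto intro: finite_subset[of _ K])

lemma Skew_finite_ssupp: "p \<in> Skew \<Longrightarrow> finite (ssupp p)"
  by (simp add: Skew_def ssupp_def)

lemma Skew_Mcar: "p \<in> Skew \<Longrightarrow> p k \<in> Mcar"
  by (simp add: Skew_def)

lemma Skew_Hcar: "p \<in> Skew \<Longrightarrow> p k \<in> Hcar"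
  by (simp add: Skew_Mcar Mcar_Hcar)

lemma not_in_ssupp: "k \<notin> ssupp p \<Longrightarrow> p k = (\<lambda>_ _. 0)"
  by (simp add: ssupp_def)

lemma Skew_add: "p \<in> Skew \<Longrightarrow> q \<in> Skew \<Longrightarrow> skew_add p q \<in> Skew"
  by (rule SkewI[of "ssupp p \<union> ssupp q"])
     (auto simp: skew_add_def Skew_finite_ssupp not_in_ssupp Skew_Mcar Mcar_add)

lemma Skew_scale: "p \<in> Skew \<Longrightarrow> skew_scale c p \<in> Skew"
  by (rule SkewI[of "ssupp p"])
     (auto simp: skew_scale_def Skew_finite_ssupp not_in_ssupp Skew_Mcar Mcar_cmult)

lemma skew_mono_eq:
  "skew_mono i j k = (\<lambda>m. if m = k then hom (real (4 * i + 6 * j)) (Emono i j) else (\<lambda>_ _. 0))"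
  unfolding skew_mono_def Emono_def by (rule refl)

lemma Skew_mono: "skew_mono i j k \<in> Skew"
  by (rule SkewI[of "{k}"]) (auto simp: skew_mono_eq Mcar_hom Emono_in_Mk)

text \<open>Indexes the terms of all coefficients of the product at once; grouping them by
  \<open>skew_deg\<close>, the resulting power of \<xi>, recovers the single coefficients.\<close>

definition skew_idx :: "skew \<Rightarrow> skew \<Rightarrow> (nat \<times> nat \<times> nat) set" where
  "skew_idx p q = (SIGMA a:ssupp p. ssupp q \<times> {..a})"

definition skew_deg :: "nat \<times> nat \<times> nat \<Rightarrow> nat" where
  "skew_deg = (\<lambda>(a, b, i). a + b - i)"

lemma finite_skew_idx: "p \<in> Skew \<Longrightarrow> q \<in> Skew \<Longrightarrow> finite (skew_idx p q)"
  by (simp add: skew_idx_def Skew_finite_ssupp)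

lemma skew_mult_eq:
  "skew_mult p q m = (\<lambda>n z. \<Sum>t\<in>{t \<in> skew_idx p q. skew_deg t = m}.
     of_nat (fst t choose snd (snd t)) * grmult (p (fst t)) ((deltaH ^^ snd (snd t)) (q (fst (snd t)))) n z)"
proof -
  have "{(a, b, i). a \<in> ssupp p \<and> b \<in> ssupp q \<and> i \<le> a \<and> a + b - i = m} =
      {t \<in> skew_idx p q. skew_deg t = m}"
    by (auto simp: skew_idx_def skew_deg_def)
  then show ?thesis by (simp add: skew_mult_def case_prod_unfold)
qed

lemma Skew_mult:
  assumes "p \<in> Skew" "q \<in> Skew" shows "skew_mult p q \<in> Skew"
proof (rule SkewI[of "skew_deg ` skew_idx p q"])
  show "skew_mult p q m = (\<lambda>_ _. 0)" if "m \<notin> skew_deg ` skew_idx p q" for m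
  proof -
    have "{t \<in> skew_idx p q. skew_deg t = m} = {}" using that by auto
    then show ?thesis by (simp only: skew_mult_eq sum.empty)
  qed
qed (use assms in \<open>auto simp: finite_skew_idx skew_mult_eq Skew_Mcar
    intro!: Mcar_sum Mcar_cmult Mcar_grmult Mcar_deltaH_pow\<close>)

section \<open>The action \<open>Phi\<close> and its compatibility with the algebra
  operations\<close>

definition Phi :: "skew \<Rightarrow> gr \<Rightarrow> gr" where
  "Phi p = restr (\<lambda>h n z. \<Sum>k\<in>ssupp p. grmult (p k) ((deltaH ^^ k) h) n z)"

lemma Phi_outside: "h \<notin> Hcar \<Longrightarrow> Phi p h = (\<lambda>_ _. 0)"
  by (simp add: Phi_def restr_def)

lemma Phi_eq_sum:
  assumes "h \<in> Hcar" "finite K" "ssupp p \<subseteq> K"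
  shows "Phi p h = (\<lambda>n z. \<Sum>k\<in>K. grmult (p k) ((deltaH ^^ k) h) n z)"
proof (intro ext)
  fix n z
  show "Phi p h n z = (\<Sum>k\<in>K. grmult (p k) ((deltaH ^^ k) h) n z)"
    using assms by (auto simp: Phi_def restr_def not_in_ssupp intro!: sum.mono_neutral_left)
qed

lemma Phi_in_Hcar: "p \<in> Skew \<Longrightarrow> Phi p h \<in> Hcar"
  unfolding Phi_def restr_def
  by (auto simp: Skew_Hcar intro!: Hcar_sum grmult_in_Hcar deltaH_pow_in_Hcar)

lemma Phi_add:
  assumes "p \<in> Skew" "q \<in> Skew"
  shows "Phi (skew_add p q) = radd (Phi p) (Phi q)"
proof
  fix h
  let ?K = "ssupp p \<union> ssupp q"
  have "ssupp (skew_add p q) \<subseteq> ?K" by (auto simp: ssupp_def skew_add_def)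
  moreover have "finite ?K" using assms by (simp add: Skew_finite_ssupp)
  ultimately show "Phi (skew_add p q) h = radd (Phi p) (Phi q) h"
    using assms
    by (cases "h \<in> Hcar")
       (simp_all add: Phi_outside radd_def Phi_eq_sum[where K = ?K] skew_add_def grmult_add_left
        Skew_Hcar sum.distrib)
qed

lemma Phi_scale:
  assumes "p \<in> Skew"
  shows "Phi (skew_scale c p) = rscale c (Phi p)"
proof
  fix h
  have "ssupp (skew_scale c p) \<subseteq> ssupp p" by (auto simp: ssupp_def skew_scale_def)
  then show "Phi (skew_scale c p) h = rscale c (Phi p) h"
    using assms
    by (cases "h \<in> Hcar")
       (simp_all add: Phi_outside rscale_def Phi_eq_sum[where K = "ssupp p"] skew_scale_def
        grmult_cmult_left Skew_Hcar Skew_finite_ssupp sum_distrib_left)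
qed

text \<open>Moving \<open>deltaH ^^ a\<close> past the coefficients of \<open>q\<close> by the
  iterated Leibniz rule produces exactly the binomial terms of \<open>skew_mult\<close>.\<close>

lemma Phi_mult:
  assumes "p \<in> Skew" "q \<in> Skew"
  shows "Phi (skew_mult p q) = Phi p \<circ> Phi q"
proof
  fix h
  show "Phi (skew_mult p q) h = (Phi p \<circ> Phi q) h"
  proof (cases "h \<in> Hcar")
    case True
    let ?T = "skew_idx p q"
    let ?G = "\<lambda>a b i n z. of_nat (a choose i) *
      grmult (p a) (grmult ((deltaH ^^ i) (q b)) ((deltaH ^^ (a + b - i)) h)) n z"
    have H: "(deltaH ^^ i) (q b) \<in> Hcar" "(deltaH ^^ j) h \<in> Hcar" "p a \<in> Hcar" for a b i j
      using assms True by (auto intro: deltaH_pow_in_Hcar Skew_Hcar)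
    show ?thesis
    proof (intro ext)
      fix n z
      have supp: "ssupp (skew_mult p q) \<subseteq> skew_deg ` ?T"
      proof
        fix m assume m: "m \<in> ssupp (skew_mult p q)"
        show "m \<in> skew_deg ` ?T"
        proof (rule ccontr)
          assume "m \<notin> skew_deg ` ?T"
          then have "{t \<in> ?T. skew_deg t = m} = {}" by auto
          then have "skew_mult p q m = (\<lambda>_ _. 0)" by (simp only: skew_mult_eq sum.empty)
          then show False using m by (simp add: ssupp_def)
        qed
      qed
      have "Phi (skew_mult p q) h n z = (\<Sum>m\<in>skew_deg ` ?T. grmult (skew_mult p q m) ((deltaH ^^ m) h) n z)"
        using True assms supp by (subst Phi_eq_sum) (auto simp: finite_skew_idx)
      also have "\<dots> = (\<Sum>m\<in>skew_deg ` ?T. \<Sum>t\<in>{t \<in> ?T. skew_deg t = m}.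
          ?G (fst t) (fst (snd t)) (snd (snd t)) n z)"
      proof (intro sum.cong refl)
        fix m
        have "grmult (skew_mult p q m) ((deltaH ^^ m) h) n z =
          (\<Sum>t\<in>{t \<in> ?T. skew_deg t = m}. of_nat (fst t choose snd (snd t)) *
            grmult (grmult (p (fst t)) ((deltaH ^^ snd (snd t)) (q (fst (snd t))))) ((deltaH ^^ m) h) n z)"
          unfolding skew_mult_eq using finite_skew_idx[OF assms]
          by (intro grmult_sum_left) (auto simp: H intro!: Hcar_finite_supp grmult_in_Hcar)
        also have "\<dots> = (\<Sum>t\<in>{t \<in> ?T. skew_deg t = m}. ?G (fst t) (fst (snd t)) (snd (snd t)) n z)"
          by (intro sum.cong refl) (auto simp: grmult_assoc H skew_deg_def)
        finally show "grmult (skew_mult p q m) ((deltaH ^^ m) h) n z = \<dots>" .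
      qed
      \<comment> \<open>The terms grouped by degree are collected into one sum over all
        triples.\<close>
      also have "\<dots> = (\<Sum>t\<in>?T. ?G (fst t) (fst (snd t)) (snd (snd t)) n z)"
        by (rule sum.group) (auto simp: finite_skew_idx[OF assms])
      also have "\<dots> = (\<Sum>a\<in>ssupp p. \<Sum>b\<in>ssupp q. \<Sum>i\<le>a. ?G a b i n z)"
        unfolding skew_idx_def
        using Skew_finite_ssupp[OF assms(1)] Skew_finite_ssupp[OF assms(2)]
        by (simp add: sum.Sigma case_prod_unfold)
      also have "\<dots> = (\<Sum>a\<in>ssupp p. grmult (p a) ((deltaH ^^ a) (Phi q h)) n z)"
      proof (intro sum.cong refl)
        fix a
        have "(deltaH ^^ a) (Phi q h) = (\<lambda>n z. \<Sum>b\<in>ssupp q. \<Sum>i\<le>a. of_nat (a choose i) *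
            grmult ((deltaH ^^ i) (q b)) ((deltaH ^^ (a + b - i)) h) n z)"
        proof -
          have "(deltaH ^^ (a - i)) ((deltaH ^^ b) h) = (deltaH ^^ (a + b - i)) h" if "i \<le> a" for b i
            using that by (simp flip: funpow_add comp_apply[where f = "deltaH ^^ (a - i)"])
          then show ?thesis
            using True assms
            by (simp add: Phi_eq_sum[OF _ Skew_finite_ssupp subset_refl] deltaH_pow_sum grmult_in_Hcar
                deltaH_pow_in_Hcar Skew_Hcar deltaH_pow_grmult)
        qed
        then show "(\<Sum>b\<in>ssupp q. \<Sum>i\<le>a. ?G a b i n z) = grmult (p a) ((deltaH ^^ a) (Phi q h)) n z"
          using grmult_sum_right[of "p a" "\<lambda>_. 1" "\<lambda>b n z. \<Sum>i\<le>a. of_nat (a choose i) *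
            grmult ((deltaH ^^ i) (q b)) ((deltaH ^^ (a + b - i)) h) n z" "ssupp q" n z]
          by (simp add: grmult_sum_right)
      qed
      also have "\<dots> = (Phi p \<circ> Phi q) h n z"
        using assms by (simp add: Phi_eq_sum[OF Phi_in_Hcar Skew_finite_ssupp subset_refl])
      finally show "Phi (skew_mult p q) h n z = (Phi p \<circ> Phi q) h n z" .
    qed
  next
    case False
    \<comment> \<open>Off \<open>Hcar\<close>, \<open>Phi q h\<close> is the zero element, which
      does lie in \<open>Hcar\<close>; so \<open>Phi p\<close> has to be computed at 0.\<close>
    have "(\<lambda>n z. 0) = Phi p (\<lambda>_ _. 0)"
      using assms(1) deltaH_pow_sum[of "{}"]
      by (simp add: Phi_eq_sum[OF Hcar_zero Skew_finite_ssupp subset_refl])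
    then show ?thesis using False by (simp add: Phi_outside)
  qed
qed

section \<open>The image of \<open>Phi\<close>: monomials and generators\<close>

lemma idH_apply: "idH h = (if h \<in> Hcar then h else (\<lambda>_ _. 0))"
  by (simp add: idH_def restr_def)

lemma idH_in_Hcar: "idH h \<in> Hcar"
  by (simp add: idH_apply)

lemma deltaH_pow_zero [simp]: "(deltaH ^^ k) (\<lambda>_ _. 0) = (\<lambda>_ _. 0)"
  using deltaH_pow_sum[of "{}" _ k] by simp

lemma delta_op_pow_apply: "h \<in> Hcar \<Longrightarrow> (delta_op ^^ k) h = (deltaH ^^ k) h"
  by (induction k) (auto simp: delta_op_def restr_def deltaH_pow_in_Hcar)

lemma funpow_in_Hcar: "(\<And>h. h \<in> Hcar \<Longrightarrow> A h \<in> Hcar) \<Longrightarrow> h \<in> Hcar \<Longrightarrow> (A ^^ k) h \<in> Hcar"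
  by (induction k) auto

lemma e4_apply: "h \<in> Hcar \<Longrightarrow> e4 h n z = E4 z * h (n - 4) z"
  and e6_apply: "h \<in> Hcar \<Longrightarrow> e6 h n z = E6 z * h (n - 6) z"
  by (simp_all add: e4_def e6_def restr_def grmult_hom)

lemma e4_in_Hcar: "h \<in> Hcar \<Longrightarrow> e4 h \<in> Hcar"
  and e6_in_Hcar: "h \<in> Hcar \<Longrightarrow> e6 h \<in> Hcar"
  by (simp_all add: e4_def e6_def restr_def grmult_in_Hcar hom_in_Hcar Eisenstein_in_Hol)

lemma e4_pow_apply: "h \<in> Hcar \<Longrightarrow> (e4 ^^ i) h n z = E4 z ^ i * h (n - real (4 * i)) z"
  by (induction i arbitrary: n) (simp_all add: e4_apply funpow_in_Hcar e4_in_Hcar algebra_simps)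

lemma e6_pow_apply: "h \<in> Hcar \<Longrightarrow> (e6 ^^ i) h n z = E6 z ^ i * h (n - real (6 * i)) z"
  by (induction i arbitrary: n) (simp_all add: e6_apply funpow_in_Hcar e6_in_Hcar algebra_simps)

lemma rmono_apply:
  "rmono i j k h n z = E4 z ^ i * (E6 z ^ j * (deltaH ^^ k) (idH h) (n - real (4 * i) - real (6 * j)) z)"
  by (simp add: rmono_def delta_op_pow_apply idH_in_Hcar deltaH_pow_in_Hcar e4_pow_apply e6_pow_apply
      funpow_in_Hcar e6_in_Hcar)

lemma Phi_mono: "Phi (skew_mono i j k) = rmono i j k"
proof (intro ext)
  fix h n z
  show "Phi (skew_mono i j k) h n z = rmono i j k h n z"
  proof (cases "h \<in> Hcar")
    case True
    have "ssupp (skew_mono i j k) \<subseteq> {k}" by (auto simp: ssupp_def skew_mono_def)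
    then have "Phi (skew_mono i j k) h n z = Emono i j z * (deltaH ^^ k) h (n - real (4 * i + 6 * j)) z"
      using True by (simp add: Phi_eq_sum[where K = "{k}"] skew_mono_eq grmult_hom)
    then show ?thesis
      \<comment> \<open>Off the upper half plane \<open>Emono\<close> is 0 while the powers in
        \<open>rmono\<close> may equal 1; there \<open>(deltaH ^^ k) h\<close> vanishes.\<close>
      using True Hol_outside[OF Hcar_Hol[OF deltaH_pow_in_Hcar[OF True]]]
      by (auto simp: rmono_apply idH_apply Emono_def onH_def algebra_simps)
  next
    case False
    then show ?thesis by (simp add: Phi_outside rmono_apply idH_apply)
  qed
qed

text \<open>\<open>A ^^ 0\<close> is the untruncated identity, so a factor \<open>B\<close> from
  \<open>Ralg\<close> is kept on the right to start the induction.\<close>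

lemma funpow_comp_in_Ralg: "A \<in> Ralg \<Longrightarrow> B \<in> Ralg \<Longrightarrow> (A ^^ k) \<circ> B \<in> Ralg"
  by (induction k) (simp_all add: comp_assoc R_mult)

lemma rmono_in_Ralg: "rmono i j k \<in> Ralg"
  unfolding rmono_def comp_assoc by (intro funpow_comp_in_Ralg Ralg.intros)

text \<open>Closure of this set under linear combinations reduces the inclusion of the image in
  \<open>Ralg\<close> to monomials.\<close>

definition Phi_Ralg :: "skew set" where
  "Phi_Ralg = {p \<in> Skew. Phi p \<in> Ralg}"

lemma Phi_Ralg_mono: "skew_mono i j k \<in> Phi_Ralg"
  by (simp add: Phi_Ralg_def Skew_mono Phi_mono rmono_in_Ralg)

lemma Phi_Ralg_scale: "p \<in> Phi_Ralg \<Longrightarrow> (\<lambda>m n z. c * p m n z) \<in> Phi_Ralg"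
  using Skew_scale[of p c] Phi_scale[of p c] R_scale[of "Phi p" c]
  by (simp add: Phi_Ralg_def skew_scale_def)

lemma Phi_Ralg_sum:
  "(\<And>i. i \<in> I \<Longrightarrow> p i \<in> Phi_Ralg) \<Longrightarrow> (\<lambda>m n z. \<Sum>i\<in>I. p i m n z) \<in> Phi_Ralg"
proof (induction I rule: infinite_finite_induct)
  case (insert i I)
  then have "skew_add (p i) (\<lambda>m n z. \<Sum>i\<in>I. p i m n z) \<in> Phi_Ralg"
    by (simp add: Phi_Ralg_def Skew_add Phi_add R_add)
  then show ?case using insert by (simp add: skew_add_def)
\<comment> \<open>Empty and infinite index sets give the zero polynomial, obtained as 0 times a
  monomial.\<close>
qed (use Phi_Ralg_scale[OF Phi_Ralg_mono, of 0 0 0 0] in auto)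

lemma Phi_in_Ralg:
  assumes "p \<in> Skew" shows "Phi p \<in> Ralg"
proof -
  have ex: "\<exists>c. p k n = (\<lambda>z. \<Sum>(i, j)\<in>wts n. c (i, j) * Emono i j z)" for k n
    using Skew_Mcar[OF assms] by (simp add: Mcar_def Mk_iff)
  \<comment> \<open>One choice of coefficients per component; any representation by monomials will
    do.\<close>
  define c where "c k n = (SOME c. p k n = (\<lambda>z. \<Sum>(i, j)\<in>wts n. c (i, j) * Emono i j z))" for k n
  have c: "p k n = (\<lambda>z. \<Sum>(i, j)\<in>wts n. c k n (i, j) * Emono i j z)" for k n
    unfolding c_def by (rule someI_ex[OF ex])
  \<comment> \<open>Expansion over powers of \<xi>, then weights, then the monomials of each
    weight.\<close>
  have "p = (\<lambda>m n z. \<Sum>k\<in>ssupp p. \<Sum>l\<in>supp (p k). \<Sum>t\<in>wts l.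
      c k l t * skew_mono (fst t) (snd t) k m n z)"
  proof (intro ext)
    fix m n z
    have "(\<Sum>t\<in>wts l. c k l t * skew_mono (fst t) (snd t) k m n z) =
        (if k = m then (if l = n then p m n z else 0) else 0)" for k l
    proof -
      have "skew_mono (fst t) (snd t) k m n z =
          (if k = m \<and> l = n then Emono (fst t) (snd t) z else 0)" if "t \<in> wts l" for t
        using that by (auto simp: skew_mono_eq hom_def wts_def)
      then have "(\<Sum>t\<in>wts l. c k l t * skew_mono (fst t) (snd t) k m n z) =
          (\<Sum>t\<in>wts l. if k = m \<and> l = n then c m n t * Emono (fst t) (snd t) z else 0)"
        by (intro sum.cong) auto
      also have "\<dots> = (if k = m then (if l = n then p m n z else 0) else 0)"
        by (auto simp: c[of m n] case_prod_unfold)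
      finally show ?thesis .
    qed
    then have "(\<Sum>k\<in>ssupp p. \<Sum>l\<in>supp (p k). \<Sum>t\<in>wts l.
        c k l t * skew_mono (fst t) (snd t) k m n z) =
        (\<Sum>k\<in>ssupp p. \<Sum>l\<in>supp (p k). if k = m then (if l = n then p m n z else 0) else 0)"
      by (simp only:)
    also have "\<dots> = (\<Sum>k\<in>ssupp p. if k = m then p m n z else 0)"
    proof (intro sum.cong refl)
      fix k
      have "finite (supp (p k))" using assms by (simp add: Hcar_finite_supp Skew_Hcar)
      then show "(\<Sum>l\<in>supp (p k). if k = m then (if l = n then p m n z else 0) else 0) =
          (if k = m then p m n z else 0)"
        by (cases "k = m") (simp_all add: not_in_supp)
    qed
    also have "\<dots> = p m n z"
      using assms by (simp add: Skew_finite_ssupp not_in_ssupp)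
    finally show "p m n z = (\<Sum>k\<in>ssupp p. \<Sum>l\<in>supp (p k). \<Sum>t\<in>wts l.
        c k l t * skew_mono (fst t) (snd t) k m n z)" ..
  qed
  also have "\<dots> \<in> Phi_Ralg"
    by (intro Phi_Ralg_sum Phi_Ralg_scale Phi_Ralg_mono)
  finally show ?thesis by (simp add: Phi_Ralg_def)
qed

text \<open>Off \<open>Hcar\<close> the left side evaluates \<open>restr A\<close> at 0, whence the
  condition that \<open>A\<close> fix 0.\<close>

lemma restr_comp_idH: "A (\<lambda>_ _. 0) = (\<lambda>_ _. 0) \<Longrightarrow> restr A \<circ> idH = restr A"
  by (auto simp: fun_eq_iff restr_def idH_apply)

lemma generators_eq_rmono:
  "delta_op = rmono 0 0 1" "e4 = rmono 1 0 0" "e6 = rmono 0 1 0" "idH = rmono 0 0 0"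
  using deltaH_pow_zero[of 1]
  by (simp_all add: rmono_def delta_op_def e4_def e6_def restr_comp_idH)

text \<open>The image of \<open>Phi\<close> is closed under the algebra operations and contains the
  generators, which are monomials.\<close>

lemma Ralg_subset_Phi: "A \<in> Ralg \<Longrightarrow> A \<in> Phi ` Skew"
proof (induction rule: Ralg.induct)
  case (R_add A B)
  then show ?case by (auto simp flip: Phi_add intro: Skew_add)
next
  case (R_scale A c)
  then show ?case by (auto simp flip: Phi_scale intro: Skew_scale)
next
  case (R_mult A B)
  then obtain p q where "p \<in> Skew" "q \<in> Skew" "A = Phi p" "B = Phi q" by blast
  then show ?case by (simp only: Phi_mult[symmetric] imageI[OF Skew_mult])
qed (simp_all only: generators_eq_rmono Phi_mono[symmetric] imageI[OF Skew_mono])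

section \<open>Faithfulness\<close>

text \<open>The order of vanishing drops by exactly one: differentiating the power contributes
  \<open>(j + 1) g(z0) / (2 pi i)\<close> to the new leading coefficient, and the \<open>E2\<close>
  term keeps at least the old order.\<close>

lemma Dser_vanishing_order:
  assumes "g \<in> Hol" "z0 \<in> uhp" "g z0 \<noteq> 0"
  obtains g' where "g' \<in> Hol" "g' z0 \<noteq> 0"
    "Dser k (\<lambda>z. (z - z0) ^ Suc j * g z) = (\<lambda>z. (z - z0) ^ j * g' z)"
proof -
  \<comment> \<open>Truncated so as to lie in \<open>Hol\<close>; then \<open>Dser_mult\<close>
    applies with the weights 0 and \<open>k\<close>.\<close>
  define P where "P = onH (\<lambda>z. (z - z0) ^ Suc j)"
  have P: "P \<in> Hol" unfolding P_def by (intro onH_in_Hol holomorphic_intros)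
  have "qderiv P z = (of_nat (Suc j) * (z - z0) ^ j) / (2 * of_real pi * \<i>)" if "z \<in> uhp" for z
  proof -
    have "((\<lambda>z. (z - z0) ^ Suc j) has_field_derivative of_nat (Suc j) * (z - z0) ^ j) (at z)"
      by (auto intro!: derivative_eq_intros simp del: power_Suc)
    from has_field_derivative_onH[OF this that] show ?thesis
      using that by (simp add: qderiv_def onH_def[of "\<lambda>z. deriv _ z / _"] P_def DERIV_imp_deriv
          del: power_Suc of_nat_Suc)
  qed
  then have DP: "Dser 0 P z * g z = (of_nat (Suc j) * (z - z0) ^ j) / (2 * of_real pi * \<i>) * g z" for z
    using Hol_outside[OF assms(1)] by (cases "z \<in> uhp") (auto simp: Dser_def simp del: of_nat_Suc)
  have Pz: "P z * f z = (z - z0) ^ Suc j * f z" if "f \<in> Hol" for f z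
    using Hol_outside[OF that] by (auto simp: P_def onH_def)
  \<comment> \<open>The second summand vanishes at \<open>z0\<close>, so \<open>g' z0\<close> is a
    nonzero multiple of \<open>g z0\<close>.\<close>
  define g' where "g' = (\<lambda>z. of_nat (Suc j) / (2 * of_real pi * \<i>) * g z + (onH (\<lambda>z. z - z0) z) * Dser k g z)"
  show thesis
  proof
    have "onH (\<lambda>z. z - z0) \<in> Hol" by (intro onH_in_Hol holomorphic_intros)
    then show "g' \<in> Hol" unfolding g'_def using assms by (intro Hol_add Hol_cmult Hol_mult Dser_in_Hol)
    show "g' z0 \<noteq> 0" using assms by (simp add: g'_def onH_def del: of_nat_Suc)
    have "Dser k (\<lambda>z. (z - z0) ^ Suc j * g z) = Dser (0 + k) (\<lambda>z. P z * g z)"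
      by (simp only: Pz[OF assms(1)] add_0)
    also have "\<dots> = (\<lambda>z. Dser 0 P z * g z + P z * Dser k g z)"
      by (rule Dser_mult[OF P assms(1)])
    also have "\<dots> = (\<lambda>z. (z - z0) ^ j * g' z)"
    proof
      fix z
      have eq: "onH (\<lambda>z. z - z0) z * Dser k g z = (z - z0) * Dser k g z"
        using Hol_outside[OF Dser_in_Hol[OF assms(1)]] by (auto simp: onH_def)
      show "Dser 0 P z * g z + P z * Dser k g z = (z - z0) ^ j * g' z"
        unfolding DP Pz[OF Dser_in_Hol[OF assms(1)]] g'_def eq
        by (simp add: algebra_simps del: of_nat_Suc)
    qed
    finally show "Dser k (\<lambda>z. (z - z0) ^ Suc j * g z) = (\<lambda>z. (z - z0) ^ j * g' z)" .
  qed
qed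

text \<open>Each \<open>deltaH\<close> costs one order of vanishing and raises the weight by 2,
  while the cofactor stays nonzero at \<open>z0\<close>.\<close>

lemma deltaH_pow_vanishing_order:
  assumes "z0 \<in> uhp" "k \<le> K"
  obtains g where "g \<in> Hol" "g z0 \<noteq> 0"
    "(deltaH ^^ k) (hom 0 (\<lambda>z. (z - z0) ^ K * onH (\<lambda>_. 1) z)) =
       hom (real (2 * k)) (\<lambda>z. (z - z0) ^ (K - k) * g z)"
proof -
  have "\<exists>g. g \<in> Hol \<and> g z0 \<noteq> 0 \<and> (deltaH ^^ k) (hom 0 (\<lambda>z. (z - z0) ^ K * onH (\<lambda>_. 1) z)) =
       hom (real (2 * k)) (\<lambda>z. (z - z0) ^ (K - k) * g z)"
    using assms(2)
  proof (induction k)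
    case 0
    have "onH (\<lambda>_. 1) \<in> Hol" by (intro onH_in_Hol holomorphic_intros)
    moreover have "onH (\<lambda>_. 1) z0 \<noteq> 0" using assms(1) by (simp add: onH_def)
    ultimately show ?case by auto
  next
    case (Suc k)
    then obtain g where g: "g \<in> Hol" "g z0 \<noteq> 0"
      "(deltaH ^^ k) (hom 0 (\<lambda>z. (z - z0) ^ K * onH (\<lambda>_. 1) z)) =
         hom (real (2 * k)) (\<lambda>z. (z - z0) ^ Suc (K - Suc k) * g z)"
      by (auto simp: Suc_diff_Suc)
    obtain g' where g': "g' \<in> Hol" "g' z0 \<noteq> 0"
      "Dser (real (2 * k)) (\<lambda>z. (z - z0) ^ Suc (K - Suc k) * g z) = (\<lambda>z. (z - z0) ^ (K - Suc k) * g' z)"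
      using Dser_vanishing_order[OF g(1) assms(1) g(2)] by blast
    have "deltaH (hom (real (2 * k)) f) = hom (real (2 * Suc k)) (Dser (real (2 * k)) f)" for f
      by (auto simp: deltaH_def hom_def fun_eq_iff)
    then show ?case using g g' by auto
  qed
  then show thesis using that by blast
qed

lemma grmult_hom_right: "finite (supp r) \<Longrightarrow> grmult r (hom l f) n z = r (n - l) z * f z"
proof -
  assume fin: "finite (supp r)"
  have "grmult r (hom l f) n z = (\<Sum>a\<in>supp r. if a = n - l then r (n - l) z * f z else 0)"
    unfolding grmult_def by (intro sum.cong) (auto simp: hom_def)
  also have "\<dots> = r (n - l) z * f z" using fin by (simp add: not_in_supp)
  finally show ?thesis .
qed

text \<open>A function vanishing to order \<open>K\<close> at \<open>z0\<close>, where \<open>K\<close> is the degree in \<open>\<xi>\<close>,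
  isolates the leading coefficient at \<open>z0\<close>.\<close>

lemma Phi_eq_zero_imp:
  assumes p: "p \<in> Skew" and Phi0: "Phi p = (\<lambda>_ _ _. 0)"
  shows "p = (\<lambda>_ _ _. 0)"
proof (rule ccontr)
  assume "p \<noteq> (\<lambda>_ _ _. 0)"
  then have ne: "ssupp p \<noteq> {}" by (auto simp: ssupp_def)
  define K where "K = Max (ssupp p)"
  have K: "K \<in> ssupp p" "\<And>k. k \<in> ssupp p \<Longrightarrow> k \<le> K"
    using ne Skew_finite_ssupp[OF p] by (auto simp: K_def)
  have "p K m z0 = 0" for m z0
  proof (cases "z0 \<in> uhp")
    case True
    define h where "h = hom 0 (\<lambda>z. (z - z0) ^ K * onH (\<lambda>_. 1) z)"
    \<comment> \<open>\<open>deltaH ^^ K\<close> moves \<open>h\<close> from degree 0 to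
      \<open>2 * K\<close>, so the weight \<open>m\<close> component of \<open>p K\<close> shows up
      in degree \<open>n\<close>.\<close>
    define n where "n = m + real (2 * K)"
    have h: "h \<in> Hcar"
    proof -
      have "(\<lambda>z. (z - z0) ^ K * onH (\<lambda>_. 1) z) = onH (\<lambda>z. (z - z0) ^ K)"
        by (simp add: onH_def fun_eq_iff)
      then show ?thesis
        unfolding h_def by (auto intro!: hom_in_Hcar onH_in_Hol holomorphic_intros)
    qed
    have lower: "grmult (p k) ((deltaH ^^ k) h) n z0 = 0" if "k \<in> ssupp p - {K}" for k
    proof -
      have k: "k < K" using K(2)[of k] that by auto
      obtain g where g: "(deltaH ^^ k) h = hom (real (2 * k)) (\<lambda>z. (z - z0) ^ (K - k) * g z)"
        using deltaH_pow_vanishing_order[OF True, of k K] k unfolding h_def by auto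
      \<comment> \<open>Here \<open>K - k > 0\<close>, so the factor
        \<open>(z - z0) ^ (K - k)\<close> is 0 at \<open>z0\<close>.\<close>
      show ?thesis
        using k by (simp add: g grmult_hom_right Hcar_finite_supp Skew_Hcar p)
    qed
    obtain g where g: "g z0 \<noteq> 0" "(deltaH ^^ K) h = hom (real (2 * K)) (\<lambda>z. (z - z0) ^ (K - K) * g z)"
      using deltaH_pow_vanishing_order[OF True, of K K] unfolding h_def by auto
    have "0 = (\<Sum>k\<in>ssupp p. grmult (p k) ((deltaH ^^ k) h) n z0)"
      using fun_cong[OF fun_cong[OF fun_cong[OF Phi0, of h], of n], of z0]
      by (simp add: Phi_eq_sum[OF h Skew_finite_ssupp[OF p] subset_refl])
    also have "\<dots> = grmult (p K) ((deltaH ^^ K) h) n z0"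
      using lower by (simp add: sum.remove[OF Skew_finite_ssupp[OF p] K(1)])
    also have "\<dots> = p K m z0 * g z0"
      by (simp add: g grmult_hom_right Hcar_finite_supp Skew_Hcar p n_def)
    finally show ?thesis using g by simp
  qed (use Hol_outside[OF Hcar_Hol[OF Skew_Hcar[OF p]]] in auto)
  then have "p K = (\<lambda>_ _. 0)" by auto
  then show False using K(1) by (simp add: ssupp_def)
qed

lemma inj_on_Phi: "inj_on Phi Skew"
proof (rule inj_onI)
  fix p q assume pq: "p \<in> Skew" "q \<in> Skew" "Phi p = Phi q"
  let ?d = "skew_add p (skew_scale (- 1) q)"
  have "Phi ?d = (\<lambda>_ _ _. 0)"
    using pq by (simp add: Phi_add Phi_scale Skew_scale radd_def rscale_def)
  then have "?d = (\<lambda>_ _ _. 0)" using pq by (intro Phi_eq_zero_imp Skew_add Skew_scale)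
  then show "p = q" by (simp add: skew_add_def skew_scale_def fun_eq_iff)
qed

lemma skew_one_eq_skew_mono: "skew_one = skew_mono 0 0 0"
  by (auto simp: skew_one_def skew_mono_def fun_eq_iff)

theorem theorem3p6:
  shows "\<exists>\<Phi>. bij_betw \<Phi> Skew Ralg
     \<and> (\<forall>p\<in>Skew. \<forall>q\<in>Skew. \<Phi> (skew_add p q) = radd (\<Phi> p) (\<Phi> q))
     \<and> (\<forall>c. \<forall>p\<in>Skew. \<Phi> (skew_scale c p) = rscale c (\<Phi> p))
     \<and> (\<forall>p\<in>Skew. \<forall>q\<in>Skew. \<Phi> (skew_mult p q) = \<Phi> p \<circ> \<Phi> q)
     \<and> \<Phi> skew_one = idH
     \<and> (\<forall>i j k. \<Phi> (skew_mono i j k) = rmono i j k)"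
proof (rule exI[of _ Phi])
  have "Phi ` Skew = Ralg" using Phi_in_Ralg Ralg_subset_Phi by auto
  then have "bij_betw Phi Skew Ralg" using inj_on_Phi by (simp add: bij_betw_def)
  moreover have "Phi skew_one = idH"
    by (simp add: skew_one_eq_skew_mono Phi_mono generators_eq_rmono(4))
  ultimately show "bij_betw Phi Skew Ralg
     \<and> (\<forall>p\<in>Skew. \<forall>q\<in>Skew. Phi (skew_add p q) = radd (Phi p) (Phi q))
     \<and> (\<forall>c. \<forall>p\<in>Skew. Phi (skew_scale c p) = rscale c (Phi p))
     \<and> (\<forall>p\<in>Skew. \<forall>q\<in>Skew. Phi (skew_mult p q) = Phi p \<circ> Phi q)
     \<and> Phi skew_one = idH
     \<and> (\<forall>i j k. Phi (skew_mono i j k) = rmono i j k)"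
    by (simp add: Phi_add Phi_scale Phi_mult Phi_mono)
qed

end
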